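(* Let $\mathcal{M}$ be any model category. Let $L$ be an endofunctor of the homotopy category $\mathrm{Ho}\,\mathcal{M}$ with the following properties: (a) There is a natural transformation $\eta\colon\mathrm{Id}\to L$ in $\mathrm{Ho}\,\mathcal{M}$ such that $L\eta\simeq\eta L$ and $L\eta\colon L\to LL$ is a weak equivalence on all objects. (b) There is a map $l_{X,Y}\colon\mathrm{map}(X,Y)\to\mathrm{map}(LX,LY)$ for all $X$, $Y$, which is natural in both variables in $\mathrm{Ho}\,\mathcal{M}$. (c) $(\eta_X)^*\circ l_{X,Y}\simeq(\eta_Y)_*$, as maps $\mathrm{map}(X,Y)\to\mathrm{map}(X,LY)$, for all $X$ and $Y$. Then $(\eta_X)^*\colon\mathrm{map}(LX,LY)\to\mathrm{map}(X,LY)$ is a weak equivalence for all $X$, $Y$.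
   Context: Model categories are assumed complete, cocomplete, and equipped with functorial factorizations. A functorial choice of homotopy function complexes has been made in $\mathcal{M}$: for all $X,Y$ in $\mathcal{M}$, a fibrant simplicial set $\mathrm{map}(X,Y)$, functorial in $X$ and $Y$, having the homotopy type of the diagonal of the bisimplicial set $\mathcal{M}(X^*,Y_* )$, where $X^*\to X$ is a cosimplicial resolution of $X$ and $Y\to Y_*$ is a simplicial resolution of $Y$. Since $\mathrm{map}$ takes weak equivalences in either variable to weak equivalences, it induces a functor $(\mathrm{Ho}\,\mathcal{M})^{\mathrm{op}}\times\mathrm{Ho}\,\mathcal{M}\to\mathrm{Ho}(\mathrm{sSet})$, where $\mathrm{sSet}$ is the category of simplicial sets; a morphism $f$ in $\mathrm{Ho}\,\mathcal{M}$ thus induces maps $f^*$ and $f_*$ of homotopy function complexes, well defined up to homotopy. In (a), $\simeq$ means equality in $\mathrm{Ho}\,\mathcal{M}$ and "weak equivalence" means isomorphism in $\mathrm{Ho}\,\mathcal{M}$. In (b), naturality means that the maps $l_{X,Y}$ form a natural transformation in the homotopy category of simplicial sets, with respect to morphisms of $\mathrm{Ho}\,\mathcal{M}$ in both variables. In (c), $\simeq$ means homotopic, i.e. equal in the homotopy category of simplicial sets. *)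

theory Defs
  imports "HOL-Library.Equipollence" "HOL-Library.Countable_Set"
begin

section \<open>Categories, functors, natural transformations\<close>

record ('o, 'a) cat =
  Obj :: "'o set"
  Arr :: "'a set"
  Src :: "'a \<Rightarrow> 'o"
  Tgt :: "'a \<Rightarrow> 'o"
  Ident :: "'o \<Rightarrow> 'a"
  Compose :: "'a \<Rightarrow> 'a \<Rightarrow> 'a" (infixl "\<cdot>\<index>" 70)

definition Hom :: "('o, 'a, 'm) cat_scheme \<Rightarrow> 'o \<Rightarrow> 'o \<Rightarrow> 'a set" where
  "Hom C X Y = {f \<in> Arr C. Src C f = X \<and> Tgt C f = Y}"

locale category =
  fixes C :: "('o, 'a, 'm) cat_scheme" (structure)
  assumes Src_Obj: "f \<in> Arr C \<Longrightarrow> Src C f \<in> Obj C"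
    and Tgt_Obj: "f \<in> Arr C \<Longrightarrow> Tgt C f \<in> Obj C"
    and Ident_Hom: "X \<in> Obj C \<Longrightarrow> Ident C X \<in> Hom C X X"
    and Compose_Hom: "f \<in> Hom C X Y \<Longrightarrow> g \<in> Hom C Y Z \<Longrightarrow> g \<cdot> f \<in> Hom C X Z"
    and Compose_Ident: "f \<in> Hom C X Y \<Longrightarrow> f \<cdot> Ident C X = f"
    and Ident_Compose: "f \<in> Hom C X Y \<Longrightarrow> Ident C Y \<cdot> f = f"
    and Compose_assoc: "f \<in> Hom C X Y \<Longrightarrow> g \<in> Hom C Y Z \<Longrightarrow> h \<in> Hom C Z V \<Longrightarrow>
          h \<cdot> (g \<cdot> f) = (h \<cdot> g) \<cdot> f"

definition inverse_arrows :: "('o, 'a, 'm) cat_scheme \<Rightarrow> 'a \<Rightarrow> 'a \<Rightarrow> bool" where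
  "inverse_arrows C f g \<longleftrightarrow> f \<in> Arr C \<and> g \<in> Hom C (Tgt C f) (Src C f) \<and>
     g \<cdot>\<^bsub>C\<^esub> f = Ident C (Src C f) \<and> f \<cdot>\<^bsub>C\<^esub> g = Ident C (Tgt C f)"

definition iso_arrow :: "('o, 'a, 'm) cat_scheme \<Rightarrow> 'a \<Rightarrow> bool" where
  "iso_arrow C f \<longleftrightarrow> (\<exists>g. inverse_arrows C f g)"

definition inv_arrow :: "('o, 'a, 'm) cat_scheme \<Rightarrow> 'a \<Rightarrow> 'a" where
  "inv_arrow C f = (THE g. inverse_arrows C f g)"

definition op_cat :: "('o, 'a, 'm) cat_scheme \<Rightarrow> ('o, 'a) cat" where
  "op_cat C = \<lparr>Obj = Obj C, Arr = Arr C, Src = Tgt C, Tgt = Src C, Ident = Ident C,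
     Compose = (\<lambda>g f. f \<cdot>\<^bsub>C\<^esub> g)\<rparr>"

definition prod_cat ::
  "('o, 'a, 'm) cat_scheme \<Rightarrow> ('p, 'b, 'n) cat_scheme \<Rightarrow> ('o \<times> 'p, 'a \<times> 'b) cat" where
  "prod_cat C D = \<lparr>Obj = Obj C \<times> Obj D, Arr = Arr C \<times> Arr D,
     Src = map_prod (Src C) (Src D), Tgt = map_prod (Tgt C) (Tgt D),
     Ident = map_prod (Ident C) (Ident D),
     Compose = (\<lambda>(g, g') (f, f'). (g \<cdot>\<^bsub>C\<^esub> f, g' \<cdot>\<^bsub>D\<^esub> f'))\<rparr>"

record ('o, 'a, 'p, 'b) fnctr =
  FObj :: "'o \<Rightarrow> 'p"
  FArr :: "'a \<Rightarrow> 'b"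

definition is_functor ::
  "('o, 'a, 'm) cat_scheme \<Rightarrow> ('p, 'b, 'n) cat_scheme \<Rightarrow> ('o, 'a, 'p, 'b) fnctr \<Rightarrow> bool" where
  "is_functor C D F \<longleftrightarrow>
     (\<forall>X\<in>Obj C. FObj F X \<in> Obj D) \<and>
     (\<forall>f\<in>Arr C. FArr F f \<in> Hom D (FObj F (Src C f)) (FObj F (Tgt C f))) \<and>
     (\<forall>X\<in>Obj C. FArr F (Ident C X) = Ident D (FObj F X)) \<and>
     (\<forall>f\<in>Arr C. \<forall>g\<in>Arr C. Tgt C f = Src C g \<longrightarrow>
        FArr F (g \<cdot>\<^bsub>C\<^esub> f) = FArr F g \<cdot>\<^bsub>D\<^esub> FArr F f)"

definition id_functor :: "('o, 'a, 'o, 'a) fnctr" where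
  "id_functor = \<lparr>FObj = (\<lambda>X. X), FArr = (\<lambda>f. f)\<rparr>"

definition const_functor :: "('p, 'b, 'n) cat_scheme \<Rightarrow> 'p \<Rightarrow> ('o, 'a, 'p, 'b) fnctr" where
  "const_functor D X = \<lparr>FObj = (\<lambda>_. X), FArr = (\<lambda>_. Ident D X)\<rparr>"

definition nat_trans ::
  "('o, 'a, 'm) cat_scheme \<Rightarrow> ('p, 'b, 'n) cat_scheme \<Rightarrow>
   ('o, 'a, 'p, 'b) fnctr \<Rightarrow> ('o, 'a, 'p, 'b) fnctr \<Rightarrow> ('o \<Rightarrow> 'b) \<Rightarrow> bool" where
  "nat_trans C D F G t \<longleftrightarrow>
     (\<forall>X\<in>Obj C. t X \<in> Hom D (FObj F X) (FObj G X)) \<and>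
     (\<forall>f\<in>Arr C. t (Tgt C f) \<cdot>\<^bsub>D\<^esub> FArr F f = FArr G f \<cdot>\<^bsub>D\<^esub> t (Src C f))"

text \<open>Functors and natural transformations are made extensional here, so that equality of
  objects and arrows of the functor category has its usual meaning.\<close>

definition functor_cat ::
  "('o, 'a, 'm) cat_scheme \<Rightarrow> ('p, 'b, 'n) cat_scheme \<Rightarrow>
   (('o, 'a, 'p, 'b) fnctr, ('o, 'a, 'p, 'b) fnctr \<times> ('o \<Rightarrow> 'b) \<times> ('o, 'a, 'p, 'b) fnctr) cat" where
  "functor_cat C D = (let Fs = {F. is_functor C D F \<and> FObj F \<in> extensional (Obj C) \<and>
                                   FArr F \<in> extensional (Arr C)} in
     \<lparr>Obj = Fs,
      Arr = {(F, t, G). F \<in> Fs \<and> G \<in> Fs \<and> nat_trans C D F G t \<and> t \<in> extensional (Obj C)},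
      Src = (\<lambda>(F, t, G). F), Tgt = (\<lambda>(F, t, G). G),
      Ident = (\<lambda>F. (F, \<lambda>X\<in>Obj C. Ident D (FObj F X), F)),
      Compose = (\<lambda>(G, s, H) (F, t, G'). (F, \<lambda>X\<in>Obj C. s X \<cdot>\<^bsub>D\<^esub> t X, H))\<rparr>)"


section \<open>Smallness, limits and colimits\<close>

text \<open>Smallness is relative to a set \<open>U\<close> of arrows: a set is small if its cardinality
  is strictly less than that of \<open>U\<close>.  For \<open>U\<close> of inaccessible cardinality this is smallness with
  respect to a Grothendieck universe; the definitions make sense for every \<open>U\<close>.  Up to isomorphism every small category has its objects and
  arrows in the type of the elements of \<open>U\<close>, so only such index categories are considered.\<close>

definition small :: "'u set \<Rightarrow> 'a set \<Rightarrow> bool" where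
  "small U A \<longleftrightarrow> A \<prec> U"

definition is_limit ::
  "('i, 'j, 'm) cat_scheme \<Rightarrow> ('o, 'a, 'n) cat_scheme \<Rightarrow> ('i, 'j, 'o, 'a) fnctr \<Rightarrow>
   'o \<Rightarrow> ('i \<Rightarrow> 'a) \<Rightarrow> bool" where
  "is_limit J C D X p \<longleftrightarrow>
     X \<in> Obj C \<and> nat_trans J C (const_functor C X) D p \<and>
     (\<forall>Y\<in>Obj C. \<forall>q. nat_trans J C (const_functor C Y) D q \<longrightarrow>
        (\<exists>!h. h \<in> Hom C Y X \<and> (\<forall>i\<in>Obj J. p i \<cdot>\<^bsub>C\<^esub> h = q i)))"

definition is_colimit ::
  "('i, 'j, 'm) cat_scheme \<Rightarrow> ('o, 'a, 'n) cat_scheme \<Rightarrow> ('i, 'j, 'o, 'a) fnctr \<Rightarrow>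
   'o \<Rightarrow> ('i \<Rightarrow> 'a) \<Rightarrow> bool" where
  "is_colimit J C D X p \<longleftrightarrow>
     X \<in> Obj C \<and> nat_trans J C D (const_functor C X) p \<and>
     (\<forall>Y\<in>Obj C. \<forall>q. nat_trans J C D (const_functor C Y) q \<longrightarrow>
        (\<exists>!h. h \<in> Hom C X Y \<and> (\<forall>i\<in>Obj J. h \<cdot>\<^bsub>C\<^esub> p i = q i)))"

definition complete_cat :: "'a set \<Rightarrow> ('o, 'a, 'm) cat_scheme \<Rightarrow> bool" where
  "complete_cat U C \<longleftrightarrow>
     (\<forall>(J :: ('a, 'a) cat) D. category J \<and> small U (Arr J) \<and> is_functor J C D \<longrightarrow>
        (\<exists>X p. is_limit J C D X p))"

definition cocomplete_cat :: "'a set \<Rightarrow> ('o, 'a, 'm) cat_scheme \<Rightarrow> bool" where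
  "cocomplete_cat U C \<longleftrightarrow>
     (\<forall>(J :: ('a, 'a) cat) D. category J \<and> small U (Arr J) \<and> is_functor J C D \<longrightarrow>
        (\<exists>X p. is_colimit J C D X p))"


section \<open>Model categories\<close>

record ('o, 'a) model_cat = "('o, 'a) cat" +
  Weq :: "'a set"
  Cof :: "'a set"
  Fib :: "'a set"

definition two_out_of_three :: "('o, 'a, 'm) cat_scheme \<Rightarrow> 'a set \<Rightarrow> bool" where
  "two_out_of_three C W \<longleftrightarrow>
     (\<forall>f\<in>Arr C. \<forall>g\<in>Arr C. Tgt C f = Src C g \<longrightarrow>
        (f \<in> W \<and> g \<in> W \<longrightarrow> g \<cdot>\<^bsub>C\<^esub> f \<in> W) \<and>
        (f \<in> W \<and> g \<cdot>\<^bsub>C\<^esub> f \<in> W \<longrightarrow> g \<in> W) \<and>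
        (g \<in> W \<and> g \<cdot>\<^bsub>C\<^esub> f \<in> W \<longrightarrow> f \<in> W))"

definition retract_of :: "('o, 'a, 'm) cat_scheme \<Rightarrow> 'a \<Rightarrow> 'a \<Rightarrow> bool" where
  "retract_of C f g \<longleftrightarrow>
     (\<exists>i\<in>Hom C (Src C f) (Src C g). \<exists>r\<in>Hom C (Src C g) (Src C f).
      \<exists>j\<in>Hom C (Tgt C f) (Tgt C g). \<exists>s\<in>Hom C (Tgt C g) (Tgt C f).
        r \<cdot>\<^bsub>C\<^esub> i = Ident C (Src C f) \<and> s \<cdot>\<^bsub>C\<^esub> j = Ident C (Tgt C f) \<and>
        g \<cdot>\<^bsub>C\<^esub> i = j \<cdot>\<^bsub>C\<^esub> f \<and> f \<cdot>\<^bsub>C\<^esub> r = s \<cdot>\<^bsub>C\<^esub> g)"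

definition closed_under_retracts :: "('o, 'a, 'm) cat_scheme \<Rightarrow> 'a set \<Rightarrow> bool" where
  "closed_under_retracts C K \<longleftrightarrow> (\<forall>f\<in>Arr C. \<forall>g\<in>K. retract_of C f g \<longrightarrow> f \<in> K)"

definition lifts_against :: "('o, 'a, 'm) cat_scheme \<Rightarrow> 'a \<Rightarrow> 'a \<Rightarrow> bool" where
  "lifts_against C i p \<longleftrightarrow>
     (\<forall>u\<in>Hom C (Src C i) (Src C p). \<forall>v\<in>Hom C (Tgt C i) (Tgt C p).
        p \<cdot>\<^bsub>C\<^esub> u = v \<cdot>\<^bsub>C\<^esub> i \<longrightarrow>
        (\<exists>h\<in>Hom C (Tgt C i) (Src C p). h \<cdot>\<^bsub>C\<^esub> i = u \<and> p \<cdot>\<^bsub>C\<^esub> h = v))"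

text \<open>\<open>f\<close> factors as \<open>b f \<cdot> a f\<close>, and a commutative square \<open>(u, v)\<close> from \<open>f\<close> to \<open>g\<close> induces
  \<open>e f g u v\<close> between the intermediate objects.\<close>

definition has_functorial_factorization ::
  "('o, 'a, 'm) cat_scheme \<Rightarrow> 'a set \<Rightarrow> 'a set \<Rightarrow> bool" where
  "has_functorial_factorization C K R \<longleftrightarrow>
     (\<exists>(a :: 'a \<Rightarrow> 'a) (b :: 'a \<Rightarrow> 'a) (e :: 'a \<Rightarrow> 'a \<Rightarrow> 'a \<Rightarrow> 'a \<Rightarrow> 'a).
        let Sq = (\<lambda>f g u v. f \<in> Arr C \<and> g \<in> Arr C \<and> u \<in> Hom C (Src C f) (Src C g) \<and>
                    v \<in> Hom C (Tgt C f) (Tgt C g) \<and> g \<cdot>\<^bsub>C\<^esub> u = v \<cdot>\<^bsub>C\<^esub> f) in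
        (\<forall>f\<in>Arr C. a f \<in> K \<and> b f \<in> R \<and> Src C (a f) = Src C f \<and> Tgt C (a f) = Src C (b f) \<and>
           Tgt C (b f) = Tgt C f \<and> b f \<cdot>\<^bsub>C\<^esub> a f = f) \<and>
        (\<forall>f g u v. Sq f g u v \<longrightarrow>
           e f g u v \<in> Hom C (Tgt C (a f)) (Tgt C (a g)) \<and>
           e f g u v \<cdot>\<^bsub>C\<^esub> a f = a g \<cdot>\<^bsub>C\<^esub> u \<and> b g \<cdot>\<^bsub>C\<^esub> e f g u v = v \<cdot>\<^bsub>C\<^esub> b f) \<and>
        (\<forall>f\<in>Arr C. e f f (Ident C (Src C f)) (Ident C (Tgt C f)) = Ident C (Tgt C (a f))) \<and>
        (\<forall>f g h u v u' v'. Sq f g u v \<and> Sq g h u' v' \<longrightarrow>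
           e f h (u' \<cdot>\<^bsub>C\<^esub> u) (v' \<cdot>\<^bsub>C\<^esub> v) = e g h u' v' \<cdot>\<^bsub>C\<^esub> e f g u v))"

locale model_category = category M
  for M :: "('o, 'a, 'm) model_cat_scheme" (structure) +
  fixes U :: "'a set"
  assumes locally_small: "X \<in> Obj M \<Longrightarrow> Y \<in> Obj M \<Longrightarrow> small U (Hom M X Y)"
    and complete: "complete_cat U M"
    and cocomplete: "cocomplete_cat U M"
    and Weq_Arr: "Weq M \<subseteq> Arr M"
    and Cof_Arr: "Cof M \<subseteq> Arr M"
    and Fib_Arr: "Fib M \<subseteq> Arr M"
    and two_out_of_three: "two_out_of_three M (Weq M)"
    and Weq_retracts: "closed_under_retracts M (Weq M)"
    and Cof_retracts: "closed_under_retracts M (Cof M)"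
    and Fib_retracts: "closed_under_retracts M (Fib M)"
    and lift_Cof: "i \<in> Cof M \<Longrightarrow> p \<in> Fib M \<inter> Weq M \<Longrightarrow> lifts_against M i p"
    and lift_Fib: "i \<in> Cof M \<inter> Weq M \<Longrightarrow> p \<in> Fib M \<Longrightarrow> lifts_against M i p"
    and factor_Cof: "has_functorial_factorization M (Cof M) (Fib M \<inter> Weq M)"
    and factor_Fib: "has_functorial_factorization M (Cof M \<inter> Weq M) (Fib M)"


section \<open>Localization\<close>

text \<open>The localization of \<open>C\<close> at \<open>W\<close>, presented as the free category on the arrows of \<open>C\<close> and
  formal reversals of the arrows in \<open>W\<close>, modulo the congruence generated by the evident relations.
  Zigzags are read in diagrammatic order.  An arrow of the localization is a triple of source,
  congruence class and target.\<close>

datatype 'a letter = Fwd 'a | Bwd 'a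

inductive zigzag :: "('o, 'a, 'm) cat_scheme \<Rightarrow> 'a set \<Rightarrow> 'o \<Rightarrow> 'a letter list \<Rightarrow> 'o \<Rightarrow> bool"
  for C :: "('o, 'a, 'm) cat_scheme" and W :: "'a set" where
  Nil: "X \<in> Obj C \<Longrightarrow> zigzag C W X [] X"
| Fwd: "f \<in> Hom C X Y \<Longrightarrow> zigzag C W Y p Z \<Longrightarrow> zigzag C W X (Fwd f # p) Z"
| Bwd: "w \<in> W \<Longrightarrow> w \<in> Hom C Y X \<Longrightarrow> zigzag C W Y p Z \<Longrightarrow> zigzag C W X (Bwd w # p) Z"

inductive zigzag_cong ::
  "('o, 'a, 'm) cat_scheme \<Rightarrow> 'a set \<Rightarrow> 'o \<Rightarrow> 'a letter list \<Rightarrow> 'a letter list \<Rightarrow> 'o \<Rightarrow> bool"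
  for C :: "('o, 'a, 'm) cat_scheme" and W :: "'a set" where
  refl: "zigzag C W X p Y \<Longrightarrow> zigzag_cong C W X p p Y"
| sym: "zigzag_cong C W X p q Y \<Longrightarrow> zigzag_cong C W X q p Y"
| trans: "zigzag_cong C W X p q Y \<Longrightarrow> zigzag_cong C W X q r Y \<Longrightarrow> zigzag_cong C W X p r Y"
| append: "zigzag_cong C W X p p' Y \<Longrightarrow> zigzag_cong C W Y q q' Z \<Longrightarrow>
    zigzag_cong C W X (p @ q) (p' @ q') Z"
| ident: "X \<in> Obj C \<Longrightarrow> zigzag_cong C W X [Fwd (Ident C X)] [] X"
| comp: "f \<in> Hom C X Y \<Longrightarrow> g \<in> Hom C Y Z \<Longrightarrow>
    zigzag_cong C W X [Fwd f, Fwd g] [Fwd (g \<cdot>\<^bsub>C\<^esub> f)] Z"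
| inv_right: "w \<in> W \<Longrightarrow> w \<in> Hom C X Y \<Longrightarrow> zigzag_cong C W X [Fwd w, Bwd w] [] X"
| inv_left: "w \<in> W \<Longrightarrow> w \<in> Hom C X Y \<Longrightarrow> zigzag_cong C W Y [Bwd w, Fwd w] [] Y"

type_synonym ('o, 'a) loc_arrow = "'o \<times> 'a letter list set \<times> 'o"

definition loc_class ::
  "('o, 'a, 'm) cat_scheme \<Rightarrow> 'a set \<Rightarrow> 'o \<Rightarrow> 'a letter list \<Rightarrow> 'o \<Rightarrow> ('o, 'a) loc_arrow" where
  "loc_class C W X p Y = (X, {q. zigzag_cong C W X p q Y}, Y)"

definition localization ::
  "('o, 'a, 'm) cat_scheme \<Rightarrow> 'a set \<Rightarrow> ('o, ('o, 'a) loc_arrow) cat" where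
  "localization C W =
     \<lparr>Obj = Obj C,
      Arr = {loc_class C W X p Y |X p Y. zigzag C W X p Y},
      Src = (\<lambda>(X, P, Y). X), Tgt = (\<lambda>(X, P, Y). Y),
      Ident = (\<lambda>X. loc_class C W X [] X),
      Compose = (\<lambda>(Y', Q, Z) (X, P, Y).
        (X, {r. \<exists>p\<in>P. \<exists>q\<in>Q. zigzag_cong C W X (p @ q) r Z}, Z))\<rparr>"

definition loc_arr :: "('o, 'a, 'm) cat_scheme \<Rightarrow> 'a set \<Rightarrow> 'a \<Rightarrow> ('o, 'a) loc_arrow" where
  "loc_arr C W f = loc_class C W (Src C f) [Fwd f] (Tgt C f)"

text \<open>The functor out of the localization induced by a functor \<open>F\<close> which inverts \<open>W\<close>: a
  reversed arrow \<open>w\<close> is sent to the inverse of \<open>F w\<close>.  The value on a congruence class is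
  computed on an arbitrary representative.\<close>

fun zigzag_value ::
  "('o, 'a, 'm) cat_scheme \<Rightarrow> ('p, 'b, 'n) cat_scheme \<Rightarrow> ('o, 'a, 'p, 'b) fnctr \<Rightarrow>
   'o \<Rightarrow> 'a letter list \<Rightarrow> 'b" where
  "zigzag_value C D F X [] = Ident D (FObj F X)"
| "zigzag_value C D F X (Fwd f # p) = zigzag_value C D F (Tgt C f) p \<cdot>\<^bsub>D\<^esub> FArr F f"
| "zigzag_value C D F X (Bwd w # p) =
     zigzag_value C D F (Src C w) p \<cdot>\<^bsub>D\<^esub> inv_arrow D (FArr F w)"

definition loc_extension ::
  "('o, 'a, 'm) cat_scheme \<Rightarrow> ('p, 'b, 'n) cat_scheme \<Rightarrow> ('o, 'a, 'p, 'b) fnctr \<Rightarrow>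
   ('o, ('o, 'a) loc_arrow, 'p, 'b) fnctr" where
  "loc_extension C D F =
     \<lparr>FObj = FObj F, FArr = (\<lambda>(X, P, Y). zigzag_value C D F X (SOME p. p \<in> P))\<rparr>"

definition Ho :: "('o, 'a, 'm) model_cat_scheme \<Rightarrow> ('o, ('o, 'a) loc_arrow) cat" where
  "Ho M = localization M (Weq M)"


section \<open>Simplicial sets\<close>

text \<open>An arrow \<open>(m, \<theta>, n)\<close> is a monotone map from \<open>{0..m}\<close> to \<open>{0..n}\<close>.\<close>

type_synonym delta_arrow = "nat \<times> (nat \<Rightarrow> nat) \<times> nat"

definition delta :: "(nat, delta_arrow) cat" where
  "delta =
     \<lparr>Obj = UNIV,
      Arr = {(m, \<theta>, n). \<theta> \<in> {..m} \<rightarrow>\<^sub>E {..n} \<and> mono_on {..m} \<theta>},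
      Src = (\<lambda>(m, \<theta>, n). m), Tgt = (\<lambda>(m, \<theta>, n). n),
      Ident = (\<lambda>n. (n, \<lambda>i\<in>{..n}. i, n)),
      Compose = (\<lambda>(n', \<phi>, k) (m, \<theta>, n). (m, compose {..m} \<phi> \<theta>, k))\<rparr>"

type_synonym 'a set_arrow = "'a set \<times> ('a \<Rightarrow> 'a) \<times> 'a set"

definition set_cat :: "'a set \<Rightarrow> ('a set, 'a set_arrow) cat" where
  "set_cat U =
     \<lparr>Obj = {A. small U A},
      Arr = {(A, f, B). small U A \<and> small U B \<and> f \<in> A \<rightarrow>\<^sub>E B},
      Src = (\<lambda>(A, f, B). A), Tgt = (\<lambda>(A, f, B). B),
      Ident = (\<lambda>A. (A, \<lambda>x\<in>A. x, A)),
      Compose = (\<lambda>(B', g, C) (A, f, B). (A, compose A g f, C))\<rparr>"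

fun set_apply :: "'a set_arrow \<Rightarrow> 'a \<Rightarrow> 'a" where
  "set_apply (A, f, B) x = f x"

type_synonym 'a sset = "(nat, delta_arrow, 'a set, 'a set_arrow) fnctr"
type_synonym 'a sset_arrow = "'a sset \<times> (nat \<Rightarrow> 'a set_arrow) \<times> 'a sset"

definition sSet :: "'a set \<Rightarrow> ('a sset, 'a sset_arrow) cat" where
  "sSet U = functor_cat (op_cat delta) (set_cat U)"

definition coface :: "nat \<Rightarrow> nat \<Rightarrow> delta_arrow" where
  "coface n i = (n, \<lambda>j\<in>{..n}. if j < i then j else Suc j, Suc n)"

definition face :: "'a sset \<Rightarrow> nat \<Rightarrow> nat \<Rightarrow> 'a \<Rightarrow> 'a" where
  "face K n i x = set_apply (FArr K (coface n i)) x"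

text \<open>Every horn, i.e. every compatible family of \<open>n\<close>-simplices indexed by all faces but the
  \<open>k\<close>-th of the standard \<open>(n+1)\<close>-simplex, has a filler.  For \<open>n = 0\<close> the compatibility
  condition is void.\<close>

definition Kan_complex :: "'a sset \<Rightarrow> bool" where
  "Kan_complex K \<longleftrightarrow>
     (\<forall>n. \<forall>k\<le>Suc n. \<forall>x.
        (\<forall>i\<le>Suc n. i \<noteq> k \<longrightarrow> x i \<in> FObj K n) \<and>
        (\<forall>i j. i < j \<and> j \<le> Suc n \<and> i \<noteq> k \<and> j \<noteq> k \<longrightarrow>
           face K (n - 1) i (x j) = face K (n - 1) (j - 1) (x i)) \<longrightarrow>
        (\<exists>y\<in>FObj K (Suc n). \<forall>i\<le>Suc n. i \<noteq> k \<longrightarrow> face K n i y = x i))"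

text \<open>A homotopy is a simplicial map from the product of the source with the standard
  1-simplex, whose \<open>n\<close>-simplices are the arrows from \<open>n\<close> to \<open>1\<close> in \<open>delta\<close>.\<close>

definition sset_homotopic :: "'a sset_arrow \<Rightarrow> 'a sset_arrow \<Rightarrow> bool" where
  "sset_homotopic = (\<lambda>(X, f, K) (X', g, K').
     X = X' \<and> K = K' \<and>
     (\<exists>H :: nat \<Rightarrow> 'a \<Rightarrow> delta_arrow \<Rightarrow> 'a.
        (\<forall>n. \<forall>x\<in>FObj X n. \<forall>s\<in>Hom delta n 1. H n x s \<in> FObj K n) \<and>
        (\<forall>m n. \<forall>\<theta>\<in>Hom delta m n. \<forall>x\<in>FObj X n. \<forall>s\<in>Hom delta n 1.
           H m (set_apply (FArr X \<theta>) x) (s \<cdot>\<^bsub>delta\<^esub> \<theta>) = set_apply (FArr K \<theta>) (H n x s)) \<and>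
        (\<forall>n. \<forall>x\<in>FObj X n. H n x (n, \<lambda>i\<in>{..n}. 0, 1) = set_apply (f n) x \<and>
                            H n x (n, \<lambda>i\<in>{..n}. 1, 1) = set_apply (g n) x)))"

text \<open>A map \<open>X \<rightarrow> Y\<close> is a weak homotopy equivalence if it induces a bijection from homotopy
  classes of maps \<open>Y \<rightarrow> K\<close> to homotopy classes of maps \<open>X \<rightarrow> K\<close> for every Kan complex \<open>K\<close>
  (Joyal and Tierney); this agrees with the definition by geometric realization.\<close>

definition sset_weq :: "'a set \<Rightarrow> 'a sset_arrow set" where
  "sset_weq U = {w \<in> Arr (sSet U). \<forall>K\<in>Obj (sSet U). Kan_complex K \<longrightarrow>
     (\<forall>u\<in>Hom (sSet U) (Src (sSet U) w) K. \<exists>v\<in>Hom (sSet U) (Tgt (sSet U) w) K.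
        sset_homotopic (v \<cdot>\<^bsub>sSet U\<^esub> w) u) \<and>
     (\<forall>v\<in>Hom (sSet U) (Tgt (sSet U) w) K. \<forall>v'\<in>Hom (sSet U) (Tgt (sSet U) w) K.
        sset_homotopic (v \<cdot>\<^bsub>sSet U\<^esub> w) (v' \<cdot>\<^bsub>sSet U\<^esub> w) \<longrightarrow> sset_homotopic v v')}"

type_synonym 'a ho_sset_arrow = "('a sset, 'a sset_arrow) loc_arrow"

definition Ho_sSet :: "'a set \<Rightarrow> ('a sset, 'a ho_sset_arrow) cat" where
  "Ho_sSet U = localization (sSet U) (sset_weq U)"

definition ho_sset_arr :: "'a set \<Rightarrow> 'a sset_arrow \<Rightarrow> 'a ho_sset_arrow" where
  "ho_sset_arr U = loc_arr (sSet U) (sset_weq U)"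


section \<open>Cosimplicial and simplicial resolutions\<close>

type_synonym ('o, 'a) cosimplicial = "(nat, delta_arrow, 'o, 'a) fnctr"
  \<comment> \<open>the same raw type serves for simplicial objects, i.e. functors on \<open>op_cat delta\<close>\<close>

text \<open>The latching category at \<open>n\<close> consists of the injections \<open>\<theta>\<close> from \<open>m < n\<close> to \<open>n\<close>; an arrow
  \<open>(\<theta>, \<phi>, \<theta>')\<close> is an injection \<open>\<phi>\<close> over \<open>n\<close>.\<close>

definition delta_inj :: "nat \<Rightarrow> nat \<Rightarrow> delta_arrow set" where
  "delta_inj m n = {(m', \<theta>, n') \<in> Hom delta m n. inj_on \<theta> {..m}}"

definition latching_cat ::
  "nat \<Rightarrow> (delta_arrow, delta_arrow \<times> delta_arrow \<times> delta_arrow) cat" where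
  "latching_cat n = (let Os = (\<Union>m\<in>{..<n}. delta_inj m n) in
     \<lparr>Obj = Os,
      Arr = {(\<theta>, \<phi>, \<theta>'). \<theta> \<in> Os \<and> \<theta>' \<in> Os \<and> \<phi> \<in> delta_inj (Src delta \<theta>) (Src delta \<theta>') \<and>
                         \<theta>' \<cdot>\<^bsub>delta\<^esub> \<phi> = \<theta>},
      Src = (\<lambda>(\<theta>, \<phi>, \<theta>'). \<theta>), Tgt = (\<lambda>(\<theta>, \<phi>, \<theta>'). \<theta>'),
      Ident = (\<lambda>\<theta>. (\<theta>, Ident delta (Src delta \<theta>), \<theta>)),
      Compose = (\<lambda>(\<theta>1, \<psi>, \<theta>'') (\<theta>, \<phi>, \<theta>'). (\<theta>, \<psi> \<cdot>\<^bsub>delta\<^esub> \<phi>, \<theta>''))\<rparr>)"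

definition latching_diagram :: "('o, 'a) cosimplicial \<Rightarrow>
    (delta_arrow, delta_arrow \<times> delta_arrow \<times> delta_arrow, 'o, 'a) fnctr" where
  "latching_diagram A =
     \<lparr>FObj = (\<lambda>\<theta>. FObj A (Src delta \<theta>)), FArr = (\<lambda>(\<theta>, \<phi>, \<theta>'). FArr A \<phi>)\<rparr>"

text \<open>\<open>l\<close> is a latching map of \<open>A\<close> at \<open>n\<close>: it is induced on a colimit of the latching diagram by
  the maps \<open>A \<theta>\<close>.\<close>

definition latching_map ::
  "('o, 'a, 'm) cat_scheme \<Rightarrow> ('o, 'a) cosimplicial \<Rightarrow> nat \<Rightarrow> 'a \<Rightarrow> bool" where
  "latching_map C A n l \<longleftrightarrow>
     (\<exists>L i. is_colimit (latching_cat n) C (latching_diagram A) L i \<and> l \<in> Hom C L (FObj A n) \<and>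
        (\<forall>\<theta>\<in>Obj (latching_cat n). l \<cdot>\<^bsub>C\<^esub> i \<theta> = FArr A \<theta>))"

definition Reedy_cofibrant ::
  "('o, 'a, 'm) model_cat_scheme \<Rightarrow> ('o, 'a) cosimplicial \<Rightarrow> bool" where
  "Reedy_cofibrant M A \<longleftrightarrow> is_functor delta M A \<and> (\<forall>n. \<exists>l. latching_map M A n l \<and> l \<in> Cof M)"

text \<open>The matching map of a simplicial object of \<open>M\<close> is its latching map as a cosimplicial
  object of \<open>op_cat M\<close>.\<close>

definition Reedy_fibrant ::
  "('o, 'a, 'm) model_cat_scheme \<Rightarrow> ('o, 'a) cosimplicial \<Rightarrow> bool" where
  "Reedy_fibrant M B \<longleftrightarrow> is_functor (op_cat delta) M B \<and>
     (\<forall>n. \<exists>l. latching_map (op_cat M) B n l \<and> l \<in> Fib M)"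

definition cosimplicial_resolution ::
  "('o, 'a, 'm) model_cat_scheme \<Rightarrow> 'o \<Rightarrow> ('o, 'a) cosimplicial \<Rightarrow> (nat \<Rightarrow> 'a) \<Rightarrow> bool" where
  "cosimplicial_resolution M X A p \<longleftrightarrow> X \<in> Obj M \<and> Reedy_cofibrant M A \<and>
     nat_trans delta M A (const_functor M X) p \<and> (\<forall>n. p n \<in> Weq M)"

definition simplicial_resolution ::
  "('o, 'a, 'm) model_cat_scheme \<Rightarrow> 'o \<Rightarrow> ('o, 'a) cosimplicial \<Rightarrow> (nat \<Rightarrow> 'a) \<Rightarrow> bool" where
  "simplicial_resolution M Y B i \<longleftrightarrow> Y \<in> Obj M \<and> Reedy_fibrant M B \<and>
     nat_trans (op_cat delta) M (const_functor M Y) B i \<and> (\<forall>n. i n \<in> Weq M)"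


section \<open>Homotopy function complexes\<close>

definition hom_set_arrow :: "('o, 'a, 'm) cat_scheme \<Rightarrow> 'a \<Rightarrow> 'a \<Rightarrow> 'a set_arrow" where
  "hom_set_arrow M a b = (Hom M (Tgt M a) (Src M b),
     \<lambda>f\<in>Hom M (Tgt M a) (Src M b). b \<cdot>\<^bsub>M\<^esub> f \<cdot>\<^bsub>M\<^esub> a, Hom M (Src M a) (Tgt M b))"

definition hom_bisimplicial ::
  "('o, 'a, 'm) cat_scheme \<Rightarrow> ('o, 'a) cosimplicial \<Rightarrow> ('o, 'a) cosimplicial \<Rightarrow>
   (nat \<times> nat, delta_arrow \<times> delta_arrow, 'a set, 'a set_arrow) fnctr" where
  "hom_bisimplicial M A B =
     \<lparr>FObj = (\<lambda>(m, n). Hom M (FObj A m) (FObj B n)),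
      FArr = (\<lambda>(\<theta>, \<phi>). hom_set_arrow M (FArr A \<theta>) (FArr B \<phi>))\<rparr>"

definition diagonal ::
  "(nat \<times> nat, delta_arrow \<times> delta_arrow, 'a set, 'a set_arrow) fnctr \<Rightarrow> 'a sset" where
  "diagonal Z = \<lparr>FObj = (\<lambda>n. FObj Z (n, n)), FArr = (\<lambda>\<theta>\<in>Arr delta. FArr Z (\<theta>, \<theta>))\<rparr>"

definition hom_diag ::
  "('o, 'a, 'm) cat_scheme \<Rightarrow> ('o, 'a) cosimplicial \<Rightarrow> ('o, 'a) cosimplicial \<Rightarrow> 'a sset" where
  "hom_diag M A B = diagonal (hom_bisimplicial M A B)"

text \<open>The simplicial map from \<open>hom_diag M A' B\<close> to \<open>hom_diag M A B'\<close> given by maps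
  \<open>a : A \<rightarrow> A'\<close> and \<open>b : B \<rightarrow> B'\<close>.\<close>

definition hom_diag_arr ::
  "('o, 'a, 'm) cat_scheme \<Rightarrow> ('o, 'a) cosimplicial \<Rightarrow> ('o, 'a) cosimplicial \<Rightarrow> (nat \<Rightarrow> 'a) \<Rightarrow>
   ('o, 'a) cosimplicial \<Rightarrow> ('o, 'a) cosimplicial \<Rightarrow> (nat \<Rightarrow> 'a) \<Rightarrow> 'a sset_arrow" where
  "hom_diag_arr M A A' a B B' b =
     (hom_diag M A' B, \<lambda>n. hom_set_arrow M (a n) (b n), hom_diag M A B')"

type_synonym ('o, 'a) mapping_functor = "('o \<times> 'o, 'a \<times> 'a, 'a sset, 'a sset_arrow) fnctr"

text \<open>A functorial choice of homotopy function complexes.  All objects have resolutions, and for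
  all resolutions \<open>p : A \<rightarrow> X\<close> and \<open>i : Y \<rightarrow> B\<close> there is an identification \<open>h\<close> of the homotopy
  type of \<open>Mp (X, Y)\<close> with that of the diagonal of \<open>M(A, B)\<close>, natural with respect to maps of
  resolutions covering arrows of \<open>M\<close>.  That \<open>Mp\<close> sends weak equivalences in either variable to
  isomorphisms of \<open>Ho_sSet U\<close> is a consequence: if \<open>w : X \<rightarrow> X'\<close> is a weak equivalence and
  \<open>p : A \<rightarrow> X\<close> is a resolution then so is \<open>w \<cdot> p : A \<rightarrow> X'\<close>, and \<open>w\<close> is covered by the identity
  of \<open>A\<close>.\<close>

definition homotopy_function_complexes ::
  "('o, 'a, 'm) model_cat_scheme \<Rightarrow> 'a set \<Rightarrow> ('o, 'a) mapping_functor \<Rightarrow> bool" where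
  "homotopy_function_complexes M U Mp \<longleftrightarrow>
     is_functor (prod_cat (op_cat M) M) (sSet U) Mp \<and>
     (\<forall>X\<in>Obj M. \<forall>Y\<in>Obj M. Kan_complex (FObj Mp (X, Y))) \<and>
     (\<forall>X\<in>Obj M. \<exists>A p. cosimplicial_resolution M X A p) \<and>
     (\<forall>Y\<in>Obj M. \<exists>B i. simplicial_resolution M Y B i) \<and>
     (\<exists>h :: 'o \<Rightarrow> ('o, 'a) cosimplicial \<Rightarrow> (nat \<Rightarrow> 'a) \<Rightarrow>
            'o \<Rightarrow> ('o, 'a) cosimplicial \<Rightarrow> (nat \<Rightarrow> 'a) \<Rightarrow> 'a ho_sset_arrow.
        (\<forall>X A p Y B i. cosimplicial_resolution M X A p \<and> simplicial_resolution M Y B i \<longrightarrow>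
           h X A p Y B i \<in> Hom (Ho_sSet U) (FObj Mp (X, Y)) (hom_diag M A B) \<and>
           iso_arrow (Ho_sSet U) (h X A p Y B i)) \<and>
        (\<forall>X A p X' A' p' f a Y B i Y' B' i' g b.
           cosimplicial_resolution M X A p \<and> cosimplicial_resolution M X' A' p' \<and>
           f \<in> Hom M X X' \<and> nat_trans delta M A A' a \<and>
           (\<forall>n. p' n \<cdot>\<^bsub>M\<^esub> a n = f \<cdot>\<^bsub>M\<^esub> p n) \<and>
           simplicial_resolution M Y B i \<and> simplicial_resolution M Y' B' i' \<and>
           g \<in> Hom M Y Y' \<and> nat_trans (op_cat delta) M B B' b \<and>
           (\<forall>n. b n \<cdot>\<^bsub>M\<^esub> i n = i' n \<cdot>\<^bsub>M\<^esub> g) \<longrightarrow>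
           ho_sset_arr U (hom_diag_arr M A A' a B B' b) \<cdot>\<^bsub>Ho_sSet U\<^esub> h X' A' p' Y B i =
           h X A p Y' B' i' \<cdot>\<^bsub>Ho_sSet U\<^esub> ho_sset_arr U (FArr Mp (f, g))))"

text \<open>The two partial functors \<open>Mp (Z, -)\<close> and \<open>Mp (-, Z)\<close> induced on homotopy categories;
  \<open>map_post\<close> sends \<open>f\<close> to \<open>f\<^sub>*\<close> and \<open>map_pre\<close> sends \<open>f\<close> to \<open>f\<^sup>*\<close>.\<close>

definition map_post ::
  "('o, 'a, 'm) model_cat_scheme \<Rightarrow> 'a set \<Rightarrow> ('o, 'a) mapping_functor \<Rightarrow> 'o \<Rightarrow>
   ('o, 'a) loc_arrow \<Rightarrow> 'a ho_sset_arrow" where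
  "map_post M U Mp Z = FArr (loc_extension M (Ho_sSet U)
     \<lparr>FObj = (\<lambda>Y. FObj Mp (Z, Y)), FArr = (\<lambda>g. ho_sset_arr U (FArr Mp (Ident M Z, g)))\<rparr>)"

definition map_pre ::
  "('o, 'a, 'm) model_cat_scheme \<Rightarrow> 'a set \<Rightarrow> ('o, 'a) mapping_functor \<Rightarrow> 'o \<Rightarrow>
   ('o, 'a) loc_arrow \<Rightarrow> 'a ho_sset_arrow" where
  "map_pre M U Mp Z = FArr (loc_extension M (op_cat (Ho_sSet U))
     \<lparr>FObj = (\<lambda>X. FObj Mp (X, Z)), FArr = (\<lambda>f. ho_sset_arr U (FArr Mp (f, Ident M Z)))\<rparr>)"

end

theory Submission
  imports Defs
begin

text \<open>Since \<open>\<eta>\<^bsub>LY\<^esub> = L \<eta>\<^sub>Y\<close> is invertible in \<open>Ho M\<close>, so is \<open>(\<eta>\<^bsub>LY\<^esub>)\<^sub>*\<close>, and the inverse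
  of \<open>(\<eta>\<^sub>X)\<^sup>*\<close> can be written down: it is the composite
  \<open>map(X, LY) \<rightarrow> map(LX, LLY) \<rightarrow> map(LX, LY)\<close> of \<open>l\<^bsub>X,LY\<^esub>\<close> and the inverse of
  \<open>(\<eta>\<^bsub>LY\<^esub>)\<^sub>*\<close>.  In one order, naturality of \<open>l\<close> in the first variable, the equality
  \<open>L \<eta>\<^sub>X = \<eta>\<^bsub>LX\<^esub>\<close> and then (c) at \<open>(LX, LY)\<close> give
  \<open>l\<^bsub>X,LY\<^esub> \<circ> (\<eta>\<^sub>X)\<^sup>* = (L \<eta>\<^sub>X)\<^sup>* \<circ> l\<^bsub>LX,LY\<^esub> = (\<eta>\<^bsub>LX\<^esub>)\<^sup>* \<circ> l\<^bsub>LX,LY\<^esub> = (\<eta>\<^bsub>LY\<^esub>)\<^sub>*\<close>.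
  In the other order, precomposition with \<open>\<eta>\<^sub>X\<close> commutes with postcomposition with \<open>\<eta>\<^bsub>LY\<^esub>\<close>,
  which reduces the claim to (c) at \<open>(X, LY)\<close>: \<open>(\<eta>\<^sub>X)\<^sup>* \<circ> l\<^bsub>X,LY\<^esub> = (\<eta>\<^bsub>LY\<^esub>)\<^sub>*\<close>.

  This argument presupposes that \<open>f\<^sup>*\<close> and \<open>g\<^sub>*\<close>, for \<open>f\<close> and \<open>g\<close> in \<open>Ho M\<close>, are functorial and
  commute with each other (\<open>map_pre_map_post\<close>).  On \<open>M\<close> itself both hold because \<open>Mp\<close> is a
  bifunctor.  They pass to \<open>Ho M\<close> by the universal property of the localization, in its form for
  functors (\<open>is_functor_loc_extension\<close>) and for natural transformations
  (\<open>nat_trans_loc_extension\<close>), once \<open>Mp\<close> is known to invert weak equivalences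
  (\<open>map_arr_Weq\<close>).  The latter holds because composing a resolution with a weak equivalence gives
  a resolution of another object by the same (co)simplicial object.\<close>


section \<open>Isomorphisms and opposite categories\<close>

lemma Hom_iff: "f \<in> Hom C X Y \<longleftrightarrow> f \<in> Arr C \<and> Src C f = X \<and> Tgt C f = Y"
  by (simp add: Hom_def)

lemma is_functorD:
  assumes "is_functor C D F"
  shows "X \<in> Obj C \<Longrightarrow> FObj F X \<in> Obj D"
    and "f \<in> Hom C X Y \<Longrightarrow> FArr F f \<in> Hom D (FObj F X) (FObj F Y)"
    and "X \<in> Obj C \<Longrightarrow> FArr F (Ident C X) = Ident D (FObj F X)"
    and "f \<in> Hom C X Y \<Longrightarrow> g \<in> Hom C Y Z \<Longrightarrow> FArr F (g \<cdot>\<^bsub>C\<^esub> f) = FArr F g \<cdot>\<^bsub>D\<^esub> FArr F f"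
  using assms by (auto simp: is_functor_def Hom_iff)

context category
begin

lemma Hom_Obj: "f \<in> Hom C X Y \<Longrightarrow> X \<in> Obj C" "f \<in> Hom C X Y \<Longrightarrow> Y \<in> Obj C"
  using Src_Obj Tgt_Obj by (auto simp: Hom_iff)

lemma inverse_arrows_iff:
  assumes "f \<in> Hom C X Y"
  shows "inverse_arrows C f g \<longleftrightarrow> g \<in> Hom C Y X \<and> g \<cdot> f = Ident C X \<and> f \<cdot> g = Ident C Y"
  using assms by (auto simp: inverse_arrows_def Hom_iff)

lemma inverse_arrows_unique:
  assumes f: "f \<in> Hom C X Y" and g: "inverse_arrows C f g" and h: "inverse_arrows C f h"
  shows "g = h"
proof -
  have g': "g \<in> Hom C Y X" "g \<cdot> f = Ident C X" and h': "h \<in> Hom C Y X" "f \<cdot> h = Ident C Y"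
    using g h inverse_arrows_iff[OF f] by auto
  have "g = g \<cdot> (f \<cdot> h)" using Compose_Ident[OF g'(1)] h'(2) by simp
  also have "\<dots> = h" using Compose_assoc[OF h'(1) f g'(1)] g'(2) Ident_Compose[OF h'(1)] by simp
  finally show ?thesis .
qed

lemma inv_arrow:
  assumes f: "f \<in> Hom C X Y" and "iso_arrow C f"
  shows "inv_arrow C f \<in> Hom C Y X" "inv_arrow C f \<cdot> f = Ident C X" "f \<cdot> inv_arrow C f = Ident C Y"
proof -
  obtain g where "inverse_arrows C f g" using assms by (auto simp: iso_arrow_def)
  then have "inverse_arrows C f (inv_arrow C f)"
    unfolding inv_arrow_def by (metis inverse_arrows_unique[OF f] theI)
  then show "inv_arrow C f \<in> Hom C Y X" "inv_arrow C f \<cdot> f = Ident C X"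
    "f \<cdot> inv_arrow C f = Ident C Y"
    using inverse_arrows_iff[OF f] by auto
qed

text \<open>The inverse of \<open>f\<close> is \<open>(g \<cdot> f)\<^sup>-\<^sup>1 \<cdot> g\<close>.\<close>

lemma iso_arrow_right_factor:
  assumes f: "f \<in> Hom C X Y" and g: "g \<in> Hom C Y Z"
    and "iso_arrow C g" and "iso_arrow C (g \<cdot> f)"
  shows "iso_arrow C f"
proof -
  note gf = Compose_Hom[OF f g]
  note g' = inv_arrow[OF g assms(3)] and k = inv_arrow[OF gf assms(4)]
  let ?k = "inv_arrow C (g \<cdot> f)"
  have fk: "f \<cdot> ?k \<in> Hom C Z Y" using k(1) f by (rule Compose_Hom)
  have "f \<cdot> ?k = (inv_arrow C g \<cdot> g) \<cdot> (f \<cdot> ?k)"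
    using g'(2) Ident_Compose[OF fk] by simp
  also have "\<dots> = inv_arrow C g \<cdot> ((g \<cdot> f) \<cdot> ?k)"
    using Compose_assoc[OF fk g g'(1)] Compose_assoc[OF k(1) f g] by simp
  also have "\<dots> = inv_arrow C g" using k(3) Compose_Ident[OF g'(1)] by simp
  finally have "f \<cdot> ?k \<cdot> g = Ident C Y" using g'(2) by simp
  then have "inverse_arrows C f (?k \<cdot> g)"
    using inverse_arrows_iff[OF f] Compose_Hom[OF g k(1)] k(2)
      Compose_assoc[OF f g k(1)] Compose_assoc[OF g k(1) f] by simp
  then show ?thesis by (auto simp: iso_arrow_def)
qed

end

lemma functor_iso_arrow:
  assumes "category C" and "category D" and F: "is_functor C D F" and "iso_arrow C f"
  shows "iso_arrow D (FArr F f)"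
proof -
  interpret C: category C by fact
  interpret D: category D by fact
  obtain g where g: "inverse_arrows C f g" using assms by (auto simp: iso_arrow_def)
  then have f: "f \<in> Hom C (Src C f) (Tgt C f)" by (simp add: inverse_arrows_def Hom_iff)
  then have g': "g \<in> Hom C (Tgt C f) (Src C f)"
    "g \<cdot>\<^bsub>C\<^esub> f = Ident C (Src C f)" "f \<cdot>\<^bsub>C\<^esub> g = Ident C (Tgt C f)"
    using g C.inverse_arrows_iff by auto
  have "inverse_arrows D (FArr F f) (FArr F g)"
    using D.inverse_arrows_iff[OF is_functorD(2)[OF F f]] is_functorD(2)[OF F g'(1)]
      is_functorD(4)[OF F f g'(1)] is_functorD(4)[OF F g'(1) f] g'(2,3)
      is_functorD(3)[OF F] C.Hom_Obj[OF f] by simp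
  then show ?thesis by (auto simp: iso_arrow_def)
qed

lemma op_cat_simps [simp]:
  "Obj (op_cat C) = Obj C" "Arr (op_cat C) = Arr C" "Src (op_cat C) = Tgt C"
  "Tgt (op_cat C) = Src C" "Ident (op_cat C) = Ident C"
  "Compose (op_cat C) g f = f \<cdot>\<^bsub>C\<^esub> g" "Hom (op_cat C) X Y = Hom C Y X"
  by (auto simp: op_cat_def Hom_def)

lemma category_op_cat:
  assumes "category C" shows "category (op_cat C)"
proof -
  interpret category C by fact
  show ?thesis
    by unfold_locales
      (auto simp: Src_Obj Tgt_Obj Ident_Hom Compose_Hom Compose_Ident Ident_Compose Compose_assoc)
qed

lemma iso_arrow_op_cat [simp]: "iso_arrow (op_cat C) f \<longleftrightarrow> iso_arrow C f"
  by (auto simp: iso_arrow_def inverse_arrows_def)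


section \<open>The localization and its universal property\<close>

lemma zigzag_append:
  "zigzag C W X p Y \<Longrightarrow> zigzag C W Y q Z \<Longrightarrow> zigzag C W X (p @ q) Z"
  by (induction rule: zigzag.induct) (auto intro: zigzag.intros)

context category
begin

lemma zigzag_Obj: "zigzag C W X p Y \<Longrightarrow> X \<in> Obj C \<and> Y \<in> Obj C"
  by (induction rule: zigzag.induct) (auto dest: Hom_Obj)

lemma zigzag_Fwd: "f \<in> Hom C X Y \<Longrightarrow> zigzag C W X [Fwd f] Y"
  and zigzag_Bwd: "w \<in> W \<Longrightarrow> w \<in> Hom C Y X \<Longrightarrow> zigzag C W X [Bwd w] Y"
  by (auto intro!: zigzag.intros dest: Hom_Obj)

lemma zigzag_cong_zigzag:
  "zigzag_cong C W X p q Y \<Longrightarrow> zigzag C W X p Y \<and> zigzag C W X q Y"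
proof (induction rule: zigzag_cong.induct)
  case (comp f X Y g Z)
  then show ?case using zigzag_Fwd[OF Compose_Hom] Hom_Obj
    by (auto intro!: zigzag.intros)
next
  case (inv_right w X Y)
  then show ?case using Hom_Obj[OF inv_right(2)] by (auto intro!: zigzag.intros)
next
  case (inv_left w X Y)
  then show ?case using Hom_Obj[OF inv_left(2)] by (auto intro!: zigzag.intros)
qed (auto intro: zigzag_append zigzag.intros Ident_Hom)

lemma loc_class_eqI: "zigzag_cong C W X p q Y \<Longrightarrow> loc_class C W X p Y = loc_class C W X q Y"
  unfolding loc_class_def
  by (auto intro: zigzag_cong.trans zigzag_cong.sym)

text \<open>Composition of classes is a union over all representatives; the congruence property of
  \<open>zigzag_cong\<close> shows that a single pair of representatives already gives everything.\<close>

lemma loc_class_Compose: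
  assumes p: "zigzag C W X p Y" and q: "zigzag C W Y q Z"
  shows "loc_class C W Y q Z \<cdot>\<^bsub>localization C W\<^esub> loc_class C W X p Y = loc_class C W X (p @ q) Z"
proof -
  have "(\<exists>p'. zigzag_cong C W X p p' Y \<and> (\<exists>q'. zigzag_cong C W Y q q' Z \<and>
           zigzag_cong C W X (p' @ q') r Z)) \<longleftrightarrow> zigzag_cong C W X (p @ q) r Z" for r
    using zigzag_cong.refl[OF p] zigzag_cong.refl[OF q] zigzag_cong.append zigzag_cong.trans
    by metis
  then show ?thesis by (simp add: localization_def loc_class_def Bex_def)
qed

lemma Hom_localization:
  "Hom (localization C W) X Y = {loc_class C W X p Y |p. zigzag C W X p Y}"
  by (auto simp: Hom_def localization_def loc_class_def)

lemma localization_simps [simp]: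
  "Obj (localization C W) = Obj C" "Ident (localization C W) X = loc_class C W X [] X"
  by (simp_all add: localization_def)

lemma category_localization: "category (localization C W)"
proof
  fix f assume "f \<in> Arr (localization C W)"
  then show "Src (localization C W) f \<in> Obj (localization C W)"
    "Tgt (localization C W) f \<in> Obj (localization C W)"
    using zigzag_Obj by (auto simp: localization_def loc_class_def)
qed (auto simp: Hom_localization loc_class_Compose zigzag_append zigzag_Obj zigzag.Nil
       intro: zigzag.Nil zigzag_append dest: zigzag_Obj)

lemma loc_arr_eq: "f \<in> Hom C X Y \<Longrightarrow> loc_arr C W f = loc_class C W X [Fwd f] Y"
  by (simp add: loc_arr_def Hom_iff)

lemma loc_arr_Hom: "f \<in> Hom C X Y \<Longrightarrow> loc_arr C W f \<in> Hom (localization C W) X Y"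
  by (auto simp: loc_arr_eq Hom_localization zigzag_Fwd)

lemma loc_arr_Ident: "X \<in> Obj C \<Longrightarrow> loc_arr C W (Ident C X) = Ident (localization C W) X"
  using loc_arr_eq[OF Ident_Hom] loc_class_eqI[OF zigzag_cong.ident] by simp

lemma loc_arr_Compose:
  assumes f: "f \<in> Hom C X Y" and g: "g \<in> Hom C Y Z"
  shows "loc_arr C W (g \<cdot> f) = loc_arr C W g \<cdot>\<^bsub>localization C W\<^esub> loc_arr C W f"
  using loc_arr_eq[OF f] loc_arr_eq[OF g] loc_arr_eq[OF Compose_Hom[OF f g]]
    loc_class_Compose[OF zigzag_Fwd[OF f] zigzag_Fwd[OF g]]
    loc_class_eqI[OF zigzag_cong.comp[OF f g]] by simp

end

text \<open>The setting of the universal property: \<open>F\<close> sends \<open>W\<close> to isomorphisms, so zigzags can be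
  evaluated in \<open>D\<close>.\<close>

locale inverting_functor = dom: category C + cod: category D
  for C :: "('o, 'a, 'm) cat_scheme" and D :: "('p, 'b, 'n) cat_scheme" +
  fixes W :: "'a set" and F :: "('o, 'a, 'p, 'b) fnctr"
  assumes is_functor: "is_functor C D F"
    and inverts: "w \<in> W \<Longrightarrow> w \<in> Arr C \<Longrightarrow> iso_arrow D (FArr F w)"
begin

lemma inv_arrow_image:
  assumes "w \<in> W" and w: "w \<in> Hom C X Y"
  shows "inv_arrow D (FArr F w) \<in> Hom D (FObj F Y) (FObj F X)"
    "inv_arrow D (FArr F w) \<cdot>\<^bsub>D\<^esub> FArr F w = Ident D (FObj F X)"
    "FArr F w \<cdot>\<^bsub>D\<^esub> inv_arrow D (FArr F w) = Ident D (FObj F Y)"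
  using cod.inv_arrow[OF is_functorD(2)[OF is_functor w]] inverts assms by (auto simp: Hom_iff)

lemma zigzag_value_Hom:
  "zigzag C W X p Y \<Longrightarrow> zigzag_value C D F X p \<in> Hom D (FObj F X) (FObj F Y)"
proof (induction rule: zigzag.induct)
  case (Nil X)
  then show ?case using cod.Ident_Hom is_functorD(1)[OF is_functor] by simp
next
  case (Fwd f X Y p Z)
  then show ?case
    using cod.Compose_Hom[OF is_functorD(2)[OF is_functor Fwd(1)]] by (auto simp: Hom_iff)
next
  case (Bwd w Y X p Z)
  then show ?case
    using cod.Compose_Hom[OF inv_arrow_image(1)[OF Bwd(1,2)]] by (auto simp: Hom_iff)
qed

lemma zigzag_value_append:
  "zigzag C W X p Y \<Longrightarrow> zigzag C W Y q Z \<Longrightarrow>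
    zigzag_value C D F X (p @ q) = zigzag_value C D F Y q \<cdot>\<^bsub>D\<^esub> zigzag_value C D F X p"
proof (induction rule: zigzag.induct)
  case (Nil X)
  then show ?case using cod.Compose_Ident[OF zigzag_value_Hom] by simp
next
  case (Fwd f X Y p V)
  then show ?case
    using cod.Compose_assoc[OF is_functorD(2)[OF is_functor Fwd(1)]
        zigzag_value_Hom[OF Fwd(2)] zigzag_value_Hom[OF Fwd(4)]]
    by (auto simp: Hom_iff)
next
  case (Bwd w Y X p V)
  then show ?case
    using cod.Compose_assoc[OF inv_arrow_image(1)[OF Bwd(1,2)]
        zigzag_value_Hom[OF Bwd(3)] zigzag_value_Hom[OF Bwd(5)]]
    by (auto simp: Hom_iff)
qed

lemma zigzag_value_Fwd: "f \<in> Hom C X Y \<Longrightarrow> zigzag_value C D F X [Fwd f] = FArr F f"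
  using cod.Ident_Compose[OF is_functorD(2)[OF is_functor]] by (auto simp: Hom_iff)

text \<open>Each generating relation of the congruence holds in \<open>D\<close>, by functoriality of \<open>F\<close> and the
  inverse laws.  Hence the value depends only on the class, which makes the arbitrary choice of a
  representative in \<open>loc_extension\<close> harmless.\<close>

lemma zigzag_value_cong:
  "zigzag_cong C W X p q Y \<Longrightarrow> zigzag_value C D F X p = zigzag_value C D F X q"
proof (induction rule: zigzag_cong.induct)
  case (append X p p' Y q q' Z)
  note * = append(1,2)[THEN dom.zigzag_cong_zigzag]
  show ?case
    using append(3,4) *[THEN conjunct1] *[THEN conjunct2] by (simp add: zigzag_value_append)
next
  case (ident X)
  then show ?case
    using zigzag_value_Fwd[OF dom.Ident_Hom] is_functorD(3)[OF is_functor] by simp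
next
  case (comp f X Y g Z)
  then have "zigzag_value C D F X ([Fwd f] @ [Fwd g]) = FArr F g \<cdot>\<^bsub>D\<^esub> FArr F f"
    using zigzag_value_append[OF dom.zigzag_Fwd dom.zigzag_Fwd] zigzag_value_Fwd by metis
  then show ?case
    using zigzag_value_Fwd[OF dom.Compose_Hom[OF comp]] is_functorD(4)[OF is_functor comp] by simp
next
  case (inv_right w X Y)
  then show ?case
    using inv_arrow_image[OF inv_right] cod.Ident_Compose[OF inv_arrow_image(1)[OF inv_right]]
    by (simp add: Hom_iff)
next
  case (inv_left w X Y)
  then show ?case
    using inv_arrow_image[OF inv_left]
      cod.Ident_Compose[OF is_functorD(2)[OF is_functor inv_left(2)]]
    by (simp add: Hom_iff)
qed simp_all

lemma loc_extension_class:
  assumes "zigzag C W X p Y"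
  shows "FArr (loc_extension C D F) (loc_class C W X p Y) = zigzag_value C D F X p"
proof -
  have "zigzag_cong C W X p (SOME q. q \<in> {q. zigzag_cong C W X p q Y}) Y"
    using someI[of "\<lambda>q. zigzag_cong C W X p q Y", OF zigzag_cong.refl[OF assms]] by simp
  from zigzag_value_cong[OF this] show ?thesis by (simp add: loc_extension_def loc_class_def)
qed

lemma is_functor_loc_extension: "is_functor (localization C W) D (loc_extension C D F)"
proof -
  let ?L = "localization C W" and ?F = "loc_extension C D F"
  have obj [simp]: "FObj ?F = FObj F" by (simp add: loc_extension_def)
  have "FArr ?F f \<in> Hom D (FObj F X) (FObj F Y)" if "f \<in> Hom ?L X Y" for f X Y
    using that by (auto simp: dom.Hom_localization loc_extension_class zigzag_value_Hom)
  moreover have "FArr ?F (g \<cdot>\<^bsub>?L\<^esub> f) = FArr ?F g \<cdot>\<^bsub>D\<^esub> FArr ?F f"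
    if "f \<in> Hom ?L X Y" "g \<in> Hom ?L Y Z" for f g X Y Z
    using that by (auto simp: dom.Hom_localization dom.loc_class_Compose zigzag_append
        loc_extension_class zigzag_value_append)
  ultimately show ?thesis
    using is_functorD(1)[OF is_functor] loc_extension_class[OF zigzag.Nil]
    by (simp add: is_functor_def Hom_iff[of _ ?L])
qed

end

text \<open>A transformation natural with respect to \<open>C\<close> is also natural with respect to the formal
  inverses, because a naturality square in which the images of an arrow are invertible
  can be read backwards; zigzags are then treated by pasting squares.\<close>

lemma nat_trans_loc_extension:
  assumes "inverting_functor C D W F" and "inverting_functor C D W G"
    and t: "nat_trans C D F G t"
  shows "nat_trans (localization C W) D (loc_extension C D F) (loc_extension C D G) t"
proof -
  interpret F: inverting_functor C D W F by fact
  interpret G: inverting_functor C D W G by fact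
  have tH: "t X \<in> Hom D (FObj F X) (FObj G X)" if "X \<in> Obj C" for X
    using t that by (simp add: nat_trans_def)
  have nat: "t Y \<cdot>\<^bsub>D\<^esub> FArr F f = FArr G f \<cdot>\<^bsub>D\<^esub> t X" if "f \<in> Hom C X Y" for f X Y
    using t that by (auto simp: nat_trans_def Hom_iff)
  have nat_inv: "t X \<cdot>\<^bsub>D\<^esub> inv_arrow D (FArr F w) = inv_arrow D (FArr G w) \<cdot>\<^bsub>D\<^esub> t Y"
    if "w \<in> W" and w: "w \<in> Hom C X Y" for w X Y
  proof -
    note f = F.inv_arrow_image[OF that] and g = G.inv_arrow_image[OF that]
    note fw = is_functorD(2)[OF F.is_functor w] and gw = is_functorD(2)[OF G.is_functor w]
    have t: "t X \<in> Hom D (FObj F X) (FObj G X)" "t Y \<in> Hom D (FObj F Y) (FObj G Y)"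
      using tH F.dom.Hom_Obj[OF w] by auto
    note tf = F.cod.Compose_Hom[OF f(1) t(1)]
    have "t X \<cdot>\<^bsub>D\<^esub> inv_arrow D (FArr F w)
        = inv_arrow D (FArr G w) \<cdot>\<^bsub>D\<^esub> (FArr G w \<cdot>\<^bsub>D\<^esub> (t X \<cdot>\<^bsub>D\<^esub> inv_arrow D (FArr F w)))"
      using F.cod.Compose_assoc[OF tf gw g(1)] g(2) F.cod.Ident_Compose[OF tf] by simp
    also have "\<dots> = inv_arrow D (FArr G w) \<cdot>\<^bsub>D\<^esub> (t Y \<cdot>\<^bsub>D\<^esub> (FArr F w \<cdot>\<^bsub>D\<^esub> inv_arrow D (FArr F w)))"
      using F.cod.Compose_assoc[OF f(1) t(1) gw] F.cod.Compose_assoc[OF f(1) fw t(2)] nat[OF w]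
      by simp
    also have "\<dots> = inv_arrow D (FArr G w) \<cdot>\<^bsub>D\<^esub> t Y"
      using f(3) F.cod.Compose_Ident[OF t(2)] by simp
    finally show ?thesis .
  qed
  \<comment> \<open>Pasting of two adjacent naturality squares.\<close>
  have step: "t Z \<cdot>\<^bsub>D\<^esub> (b \<cdot>\<^bsub>D\<^esub> a) = (b' \<cdot>\<^bsub>D\<^esub> a') \<cdot>\<^bsub>D\<^esub> t X"
    if "X \<in> Obj C" "Y \<in> Obj C" "Z \<in> Obj C"
      "a \<in> Hom D (FObj F X) (FObj F Y)" "b \<in> Hom D (FObj F Y) (FObj F Z)"
      "a' \<in> Hom D (FObj G X) (FObj G Y)" "b' \<in> Hom D (FObj G Y) (FObj G Z)"
      "t Y \<cdot>\<^bsub>D\<^esub> a = a' \<cdot>\<^bsub>D\<^esub> t X" "t Z \<cdot>\<^bsub>D\<^esub> b = b' \<cdot>\<^bsub>D\<^esub> t Y" for X Y Z a b a' b'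
    using F.cod.Compose_assoc[OF that(4,5) tH[OF that(3)]]
      F.cod.Compose_assoc[OF that(4) tH[OF that(2)] that(7)]
      F.cod.Compose_assoc[OF tH[OF that(1)] that(6,7)] that(8,9) by simp
  have zigzag_nat: "t Y \<cdot>\<^bsub>D\<^esub> zigzag_value C D F X p = zigzag_value C D G X p \<cdot>\<^bsub>D\<^esub> t X"
    if "zigzag C W X p Y" for X p Y
    using that
  proof (induction rule: zigzag.induct)
    case (Nil X)
    then show ?case using F.cod.Compose_Ident[OF tH] F.cod.Ident_Compose[OF tH] by simp
  next
    case (Fwd f X Y p Z)
    have Tgt: "Tgt C f = Y" using Fwd(1) by (simp add: Hom_iff)
    show ?case
      unfolding zigzag_value.simps Tgt using Fwd F.dom.Hom_Obj[OF Fwd(1)] F.dom.zigzag_Obj[OF Fwd(2)]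
      by (intro step[of X Y Z])
        (auto intro: is_functorD(2)[OF F.is_functor] is_functorD(2)[OF G.is_functor]
          F.zigzag_value_Hom G.zigzag_value_Hom nat)
  next
    case (Bwd w Y X p Z)
    have Src: "Src C w = Y" using Bwd(2) by (simp add: Hom_iff)
    show ?case
      unfolding zigzag_value.simps Src using Bwd F.dom.Hom_Obj[OF Bwd(2)] F.dom.zigzag_Obj[OF Bwd(3)]
      by (intro step[of X Y Z])
        (auto intro: F.inv_arrow_image(1) G.inv_arrow_image(1)
          F.zigzag_value_Hom G.zigzag_value_Hom nat_inv)
  qed
  have "t Y \<cdot>\<^bsub>D\<^esub> FArr (loc_extension C D F) f = FArr (loc_extension C D G) f \<cdot>\<^bsub>D\<^esub> t X"
    if "f \<in> Hom (localization C W) X Y" for f X Y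
    using that by (auto simp: F.dom.Hom_localization F.loc_extension_class G.loc_extension_class zigzag_nat)
  then show ?thesis using tH by (simp add: nat_trans_def loc_extension_def Hom_iff[of _ "localization C W"])
qed


section \<open>The category of simplicial sets\<close>

lemma category_delta: "category delta"
proof
  fix X :: nat show "Ident delta X \<in> Hom delta X X"
    by (auto simp: delta_def Hom_def mono_on_def)
next
  fix f g X Y Z assume "f \<in> Hom delta X Y" "g \<in> Hom delta Y Z"
  then show "g \<cdot>\<^bsub>delta\<^esub> f \<in> Hom delta X Z"
    by (auto simp: delta_def Hom_def mono_on_def compose_def PiE_iff Pi_iff)
next
  fix f X Y assume "f \<in> Hom delta X Y"
  then show "f \<cdot>\<^bsub>delta\<^esub> Ident delta X = f" "Ident delta Y \<cdot>\<^bsub>delta\<^esub> f = f"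
    by (auto simp: delta_def Hom_def compose_def PiE_iff Pi_iff extensional_def fun_eq_iff)
next
  fix f g h X Y Z V assume "f \<in> Hom delta X Y" "g \<in> Hom delta Y Z" "h \<in> Hom delta Z V"
  then show "h \<cdot>\<^bsub>delta\<^esub> (g \<cdot>\<^bsub>delta\<^esub> f) = h \<cdot>\<^bsub>delta\<^esub> g \<cdot>\<^bsub>delta\<^esub> f"
    by (auto simp: delta_def Hom_def compose_def PiE_iff Pi_iff fun_eq_iff)
qed (auto simp: delta_def)

lemma category_set_cat: "category (set_cat U)"
proof
  fix f g X Y Z assume "f \<in> Hom (set_cat U) X Y" "g \<in> Hom (set_cat U) Y Z"
  then show "g \<cdot>\<^bsub>set_cat U\<^esub> f \<in> Hom (set_cat U) X Z"
    by (auto simp: set_cat_def Hom_def compose_def PiE_iff Pi_iff)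
next
  fix f X Y assume "f \<in> Hom (set_cat U) X Y"
  then show "f \<cdot>\<^bsub>set_cat U\<^esub> Ident (set_cat U) X = f" "Ident (set_cat U) Y \<cdot>\<^bsub>set_cat U\<^esub> f = f"
    by (auto simp: set_cat_def Hom_def PiE_def compose_Id Id_compose)
next
  fix f g h X Y Z V
  assume "f \<in> Hom (set_cat U) X Y" "g \<in> Hom (set_cat U) Y Z" "h \<in> Hom (set_cat U) Z V"
  then show "h \<cdot>\<^bsub>set_cat U\<^esub> (g \<cdot>\<^bsub>set_cat U\<^esub> f) = h \<cdot>\<^bsub>set_cat U\<^esub> g \<cdot>\<^bsub>set_cat U\<^esub> f"
    by (auto simp: set_cat_def Hom_def compose_def PiE_iff Pi_iff fun_eq_iff)
qed (auto simp: set_cat_def Hom_def)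

lemma (in category) nat_trans_restrict:
  "nat_trans C D F G (restrict t (Obj C)) \<longleftrightarrow> nat_trans C D F G t"
  by (auto simp: nat_trans_def Src_Obj Tgt_Obj)

lemma nat_trans_Ident:
  assumes "category C" and "category D" and F: "is_functor C D F"
  shows "nat_trans C D F F (\<lambda>X. Ident D (FObj F X))"
proof -
  interpret C: category C by fact
  interpret D: category D by fact
  have "Ident D (FObj F Y) \<cdot>\<^bsub>D\<^esub> FArr F f = FArr F f \<cdot>\<^bsub>D\<^esub> Ident D (FObj F X)"
    if "f \<in> Hom C X Y" for f X Y
    using is_functorD(2)[OF F that] D.Ident_Compose D.Compose_Ident by metis
  then show ?thesis
    using is_functorD(1)[OF F] D.Ident_Hom by (auto simp: nat_trans_def Hom_iff[of _ C])
qed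

lemma category_functor_cat:
  assumes "category C" and "category D"
  shows "category (functor_cat C D)"
proof -
  interpret C: category C by fact
  interpret D: category D by fact
  let ?E = "functor_cat C D"
  have comp: "nat_trans C D F H (\<lambda>X\<in>Obj C. s X \<cdot>\<^bsub>D\<^esub> t X)"
    if F: "is_functor C D F" and G: "is_functor C D G" and H: "is_functor C D H"
      and t: "nat_trans C D F G t" and s: "nat_trans C D G H s" for F G H t s
    unfolding nat_trans_def
  proof (intro conjI ballI)
    fix X assume "X \<in> Obj C"
    then show "(\<lambda>X\<in>Obj C. s X \<cdot>\<^bsub>D\<^esub> t X) X \<in> Hom D (FObj F X) (FObj H X)"
      using s t D.Compose_Hom by (auto simp: nat_trans_def)
  next
    fix f assume f: "f \<in> Arr C"
    let ?X = "Src C f" and ?Y = "Tgt C f"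
    have X: "?X \<in> Obj C" and Y: "?Y \<in> Obj C" and f': "f \<in> Hom C ?X ?Y"
      using f C.Src_Obj C.Tgt_Obj by (auto simp: Hom_iff)
    note Ff = is_functorD(2)[OF F f'] and Gf = is_functorD(2)[OF G f'] and Hf = is_functorD(2)[OF H f']
    have tX: "t ?X \<in> Hom D (FObj F ?X) (FObj G ?X)" and tY: "t ?Y \<in> Hom D (FObj F ?Y) (FObj G ?Y)"
      and sX: "s ?X \<in> Hom D (FObj G ?X) (FObj H ?X)" and sY: "s ?Y \<in> Hom D (FObj G ?Y) (FObj H ?Y)"
      and nat: "t ?Y \<cdot>\<^bsub>D\<^esub> FArr F f = FArr G f \<cdot>\<^bsub>D\<^esub> t ?X" "s ?Y \<cdot>\<^bsub>D\<^esub> FArr G f = FArr H f \<cdot>\<^bsub>D\<^esub> s ?X"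
      using s t X Y f by (auto simp: nat_trans_def)
    show "(\<lambda>X\<in>Obj C. s X \<cdot>\<^bsub>D\<^esub> t X) ?Y \<cdot>\<^bsub>D\<^esub> FArr F f = FArr H f \<cdot>\<^bsub>D\<^esub> (\<lambda>X\<in>Obj C. s X \<cdot>\<^bsub>D\<^esub> t X) ?X"
      using X Y nat D.Compose_assoc[OF Ff tY sY] D.Compose_assoc[OF tX Gf sY]
        D.Compose_assoc[OF tX sX Hf] by simp
  qed
  have Hom: "Hom ?E F G = {(F, t, G) |t. F \<in> Obj ?E \<and> G \<in> Obj ?E \<and> nat_trans C D F G t \<and>
      t \<in> extensional (Obj C)}" for F G
    by (auto simp: Hom_def functor_cat_def Let_def)
  have Obj: "is_functor C D F" if "F \<in> Obj ?E" for F
    using that by (auto simp: functor_cat_def Let_def)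
  have Comp: "Compose ?E (G, s, H) (F, t, G') = (F, \<lambda>X\<in>Obj C. s X \<cdot>\<^bsub>D\<^esub> t X, H)" for F G G' H s t
    by (simp add: functor_cat_def Let_def)
  have Ident: "Ident ?E F = (F, \<lambda>X\<in>Obj C. Ident D (FObj F X), F)" for F
    by (simp add: functor_cat_def Let_def)
  show ?thesis
  proof
    fix F assume F: "F \<in> Obj ?E"
    show "Ident ?E F \<in> Hom ?E F F"
      using F nat_trans_Ident[OF assms Obj[OF F]] C.nat_trans_restrict by (auto simp: Hom Ident)
  next
    fix f g F G H assume "f \<in> Hom ?E F G" "g \<in> Hom ?E G H"
    then obtain t s where "f = (F, t, G)" "g = (G, s, H)" and FGH: "F \<in> Obj ?E" "G \<in> Obj ?E" "H \<in> Obj ?E"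
      and "nat_trans C D F G t" "nat_trans C D G H s"
      unfolding Hom by blast
    then show "Compose ?E g f \<in> Hom ?E F H"
      using comp[OF FGH[THEN Obj], of t s] by (simp add: Hom Comp)
  next
    fix f F G assume f: "f \<in> Hom ?E F G"
    then show "Compose ?E f (Ident ?E F) = f" "Compose ?E (Ident ?E G) f = f"
      by (auto simp: Hom Comp Ident nat_trans_def extensional_def fun_eq_iff
          intro!: D.Ident_Compose D.Compose_Ident)
  next
    fix f g h F G H K assume "f \<in> Hom ?E F G" "g \<in> Hom ?E G H" "h \<in> Hom ?E H K"
    then show "Compose ?E h (Compose ?E g f) = Compose ?E (Compose ?E h g) f"
      by (auto simp: Hom Comp nat_trans_def fun_eq_iff intro!: D.Compose_assoc)
  qed (auto simp: functor_cat_def Let_def)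
qed

lemma category_sSet: "category (sSet U)"
  unfolding sSet_def by (intro category_functor_cat category_op_cat category_delta category_set_cat)

lemma category_Ho_sSet: "category (Ho_sSet U)"
  unfolding Ho_sSet_def by (intro category.category_localization category_sSet)


section \<open>Homotopy function complexes on the homotopy category\<close>

context model_category
begin

lemma Weq_Compose:
  assumes "f \<in> Hom M X Y" "g \<in> Hom M Y Z" "f \<in> Weq M" "g \<in> Weq M"
  shows "g \<cdot> f \<in> Weq M"
  using two_out_of_three assms by (auto simp: two_out_of_three_def Hom_iff)

text \<open>If \<open>b\<close> is a trivial fibration onto \<open>X\<close>, obtained by factoring the identity, then both \<open>b\<close> and
  \<open>Ident X \<cdot> b = b\<close> are weak equivalences.\<close>

lemma Ident_Weq:
  assumes X: "X \<in> Obj M" shows "Ident M X \<in> Weq M"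
proof -
  note I = Ident_Hom[OF X]
  obtain b where b: "b \<in> Weq M" "Tgt M b = Tgt M (Ident M X)"
    using factor_Cof I unfolding has_functorial_factorization_def Let_def Hom_iff by blast
  then have b': "b \<in> Hom M (Src M b) X" using I Weq_Arr by (auto simp: Hom_iff)
  then have "Ident M X \<cdot> b \<in> Weq M" using b Ident_Compose by simp
  then show ?thesis
    using two_out_of_three b b' I by (auto simp: two_out_of_three_def Hom_iff)
qed

lemma category_Ho: "category (Ho M)"
  unfolding Ho_def by (rule category_localization)

lemma cosimplicial_resolution_Weq:
  assumes A: "cosimplicial_resolution M X A p" and w: "w \<in> Hom M X X'" "w \<in> Weq M"
  shows "cosimplicial_resolution M X' A (\<lambda>n. w \<cdot> p n)"
proof -
  have nt: "nat_trans delta M A (const_functor M X) p" and Af: "is_functor delta M A"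
    and pW: "\<And>n. p n \<in> Weq M"
    using A by (auto simp: cosimplicial_resolution_def Reedy_cofibrant_def)
  have O: "n \<in> Obj delta" for n by (simp add: delta_def)
  have p: "p n \<in> Hom M (FObj A n) X" for n
    using nt O by (auto simp: nat_trans_def const_functor_def)
  have wp: "w \<cdot> p n \<in> Hom M (FObj A n) X'" for n using p w(1) by (rule Compose_Hom)
  have "w \<cdot> p n \<cdot> FArr A f = w \<cdot> p m" if f: "f \<in> Hom delta m n" for f m n
  proof -
    have "p n \<cdot> FArr A f = p m"
      using nt f Ident_Compose[OF p] by (auto simp: nat_trans_def const_functor_def Hom_iff)
    then show ?thesis using Compose_assoc[OF is_functorD(2)[OF Af f] p w(1)] by simp
  qed
  then have "nat_trans delta M A (const_functor M X') (\<lambda>n. w \<cdot> p n)"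
    using wp Ident_Compose[OF wp] by (auto simp: nat_trans_def const_functor_def Hom_iff[of _ delta])
  then show ?thesis
    using A Weq_Compose[OF p w(1) pW w(2)] Hom_Obj[OF w(1)]
    by (auto simp: cosimplicial_resolution_def)
qed

lemma simplicial_resolution_Weq:
  assumes B: "simplicial_resolution M Y B i" and w: "w \<in> Hom M Y' Y" "w \<in> Weq M"
  shows "simplicial_resolution M Y' B (\<lambda>n. i n \<cdot> w)"
proof -
  have nt: "nat_trans (op_cat delta) M (const_functor M Y) B i"
    and Bf: "is_functor (op_cat delta) M B"
    and iW: "\<And>n. i n \<in> Weq M"
    using B by (auto simp: simplicial_resolution_def Reedy_fibrant_def)
  have O: "n \<in> Obj delta" for n by (simp add: delta_def)
  have i: "i n \<in> Hom M Y (FObj B n)" for n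
    using nt O by (auto simp: nat_trans_def const_functor_def)
  have iw: "i n \<cdot> w \<in> Hom M Y' (FObj B n)" for n using w(1) i by (rule Compose_Hom)
  have "FArr B f \<cdot> (i n \<cdot> w) = i m \<cdot> w" if f: "f \<in> Hom delta m n" for f m n
  proof -
    have "FArr B f \<cdot> i n = i m"
      using nt f Compose_Ident[OF i] by (auto simp: nat_trans_def const_functor_def Hom_iff)
    moreover have "FArr B f \<in> Hom M (FObj B n) (FObj B m)"
      using is_functorD(2)[OF Bf] f by simp
    ultimately show ?thesis using Compose_assoc[OF w(1) i] by simp
  qed
  then have "nat_trans (op_cat delta) M (const_functor M Y') B (\<lambda>n. i n \<cdot> w)"
    using iw Compose_Ident[OF iw]
    by (auto simp: nat_trans_def const_functor_def Hom_iff[of _ delta])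
  then show ?thesis
    using B Weq_Compose[OF w(1) i w(2) iW] Hom_Obj[OF w(1)]
    by (auto simp: simplicial_resolution_def)
qed

lemma hom_diag_arr_Ident:
  assumes A: "is_functor delta M A" and B: "is_functor (op_cat delta) M B"
  shows "hom_diag_arr M A A (\<lambda>n. Ident M (FObj A n)) B B (\<lambda>n. Ident M (FObj B n)) =
    Ident (sSet U) (hom_diag M A B)"
proof -
  have "FObj A n \<in> Obj M" "FObj B n \<in> Obj M" for n
    using is_functorD(1)[OF A, of n] is_functorD(1)[OF B, of n] by (simp_all add: delta_def)
  then have I: "Ident M (FObj A n) \<in> Hom M (FObj A n) (FObj A n)"
    "Ident M (FObj B n) \<in> Hom M (FObj B n) (FObj B n)" for n
    using Ident_Hom by auto
  have "hom_set_arrow M (Ident M (FObj A n)) (Ident M (FObj B n)) =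
      (Hom M (FObj A n) (FObj B n), \<lambda>f\<in>Hom M (FObj A n) (FObj B n). f, Hom M (FObj A n) (FObj B n))"
    for n
    using I[of n] Ident_Compose Compose_Ident
    by (auto simp: hom_set_arrow_def Hom_iff[of _ M "FObj A n" "FObj A n"]
        Hom_iff[of _ M "FObj B n" "FObj B n"] intro!: restrict_ext)
  then show ?thesis
    by (simp add: hom_diag_arr_def sSet_def functor_cat_def Let_def set_cat_def hom_diag_def
        diagonal_def hom_bisimplicial_def delta_def restrict_def)
qed

end

locale function_complexes = model_category M U
  for M :: "('o, 'a, 'm) model_cat_scheme" (structure) and U :: "'a set" +
  fixes Mp :: "('o, 'a) mapping_functor"
  assumes function_complexes: "homotopy_function_complexes M U Mp"
begin

sublocale Ho: category "Ho M" by (rule category_Ho)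
sublocale sSet: category "sSet U" by (rule category_sSet)
sublocale Ho_sSet: category "Ho_sSet U" by (rule category_Ho_sSet)
sublocale op_Ho_sSet: category "op_cat (Ho_sSet U)" by (intro category_op_cat category_Ho_sSet)

definition map_arr :: "'a \<Rightarrow> 'a \<Rightarrow> 'a ho_sset_arrow" where
  "map_arr f g = ho_sset_arr U (FArr Mp (f, g))"

lemma Mp_functor: "is_functor (prod_cat (op_cat M) M) (sSet U) Mp"
  using function_complexes by (simp add: homotopy_function_complexes_def)

lemma Mp_Hom:
  assumes "f \<in> Hom M X X'" "g \<in> Hom M Y Y'"
  shows "FArr Mp (f, g) \<in> Hom (sSet U) (FObj Mp (X', Y)) (FObj Mp (X, Y'))"
  using assms by (intro is_functorD(2)[OF Mp_functor]) (auto simp: prod_cat_def Hom_def)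

lemma map_arr_Hom:
  assumes "f \<in> Hom M X X'" "g \<in> Hom M Y Y'"
  shows "map_arr f g \<in> Hom (Ho_sSet U) (FObj Mp (X', Y)) (FObj Mp (X, Y'))"
  unfolding map_arr_def ho_sset_arr_def Ho_sSet_def by (intro sSet.loc_arr_Hom Mp_Hom assms)

lemma map_arr_Ident:
  assumes "X \<in> Obj M" "Y \<in> Obj M"
  shows "map_arr (Ident M X) (Ident M Y) = Ident (Ho_sSet U) (FObj Mp (X, Y))"
proof -
  have XY: "(X, Y) \<in> Obj (prod_cat (op_cat M) M)" using assms by (simp add: prod_cat_def)
  show ?thesis
    using is_functorD(3)[OF Mp_functor XY] sSet.loc_arr_Ident[OF is_functorD(1)[OF Mp_functor XY]]
    by (simp add: map_arr_def ho_sset_arr_def Ho_sSet_def prod_cat_def)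
qed

lemma map_arr_Compose:
  assumes f: "f \<in> Hom M X X'" and f': "f' \<in> Hom M X' X''"
    and g: "g \<in> Hom M Y Y'" and g': "g' \<in> Hom M Y' Y''"
  shows "map_arr (f' \<cdot> f) (g' \<cdot> g) = map_arr f g' \<cdot>\<^bsub>Ho_sSet U\<^esub> map_arr f' g"
proof -
  have "FArr Mp (f' \<cdot> f, g' \<cdot> g) = FArr Mp (f, g') \<cdot>\<^bsub>sSet U\<^esub> FArr Mp (f', g)"
    using is_functorD(4)[OF Mp_functor, of "(f', g)" "(X'', Y)" "(X', Y')" "(f, g')" "(X, Y'')"] assms
    by (simp add: prod_cat_def Hom_def)
  then show ?thesis
    using sSet.loc_arr_Compose[OF Mp_Hom[OF f' g] Mp_Hom[OF f g']]
    by (simp add: map_arr_def ho_sset_arr_def Ho_sSet_def)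
qed

text \<open>Given resolutions \<open>p : A \<rightarrow> X\<close> and \<open>i : Y' \<rightarrow> B\<close>, the composites \<open>f \<cdot> p\<close> and \<open>i \<cdot> g\<close> resolve
  \<open>X'\<close> and \<open>Y\<close> by the same \<open>A\<close> and \<open>B\<close>.  So \<open>Mp (X', Y)\<close> and \<open>Mp (X, Y')\<close> are both identified
  with the diagonal of \<open>M(A, B)\<close>, and \<open>map_arr f g\<close> is compatible with the identifications because
  \<open>f\<close> and \<open>g\<close> are covered by identities.\<close>

lemma map_arr_Weq:
  assumes f: "f \<in> Hom M X X'" "f \<in> Weq M" and g: "g \<in> Hom M Y Y'" "g \<in> Weq M"
  shows "iso_arrow (Ho_sSet U) (map_arr f g)"
proof -
  note X = Hom_Obj[OF f(1)] and Y = Hom_Obj[OF g(1)]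
  obtain A p where A: "cosimplicial_resolution M X A p"
    using function_complexes X by (auto simp: homotopy_function_complexes_def)
  obtain B i where B: "simplicial_resolution M Y' B i"
    using function_complexes Y by (auto simp: homotopy_function_complexes_def)
  note A' = cosimplicial_resolution_Weq[OF A f] and B' = simplicial_resolution_Weq[OF B g]
  obtain h where h: "\<And>X A p Y B i. cosimplicial_resolution M X A p \<Longrightarrow> simplicial_resolution M Y B i \<Longrightarrow>
           h X A p Y B i \<in> Hom (Ho_sSet U) (FObj Mp (X, Y)) (hom_diag M A B) \<and>
           iso_arrow (Ho_sSet U) (h X A p Y B i)"
    and nat: "\<And>X A p X' A' p' f a Y B i Y' B' i' g b.
           cosimplicial_resolution M X A p \<Longrightarrow> cosimplicial_resolution M X' A' p' \<Longrightarrow>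
           f \<in> Hom M X X' \<Longrightarrow> nat_trans delta M A A' a \<Longrightarrow>
           (\<forall>n. p' n \<cdot> a n = f \<cdot> p n) \<Longrightarrow>
           simplicial_resolution M Y B i \<Longrightarrow> simplicial_resolution M Y' B' i' \<Longrightarrow>
           g \<in> Hom M Y Y' \<Longrightarrow> nat_trans (op_cat delta) M B B' b \<Longrightarrow>
           (\<forall>n. b n \<cdot> i n = i' n \<cdot> g) \<Longrightarrow>
           ho_sset_arr U (hom_diag_arr M A A' a B B' b) \<cdot>\<^bsub>Ho_sSet U\<^esub> h X' A' p' Y B i =
           h X A p Y' B' i' \<cdot>\<^bsub>Ho_sSet U\<^esub> ho_sset_arr U (FArr Mp (f, g))"
    using function_complexes unfolding homotopy_function_complexes_def by metis
  have Af: "is_functor delta M A" and Bf: "is_functor (op_cat delta) M B"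
    and nA: "nat_trans delta M A (const_functor M X) p"
    and nB: "nat_trans (op_cat delta) M (const_functor M Y') B i"
    using A B by (auto simp: cosimplicial_resolution_def Reedy_cofibrant_def
        simplicial_resolution_def Reedy_fibrant_def)
  let ?a = "\<lambda>n. Ident M (FObj A n)" and ?b = "\<lambda>n. Ident M (FObj B n)"
  let ?h' = "h X' A (\<lambda>n. f \<cdot> p n) Y B (\<lambda>n. i n \<cdot> g)" and ?h = "h X A p Y' B i"
  note h1 = h[OF A B] and h2 = h[OF A' B']
  have p: "f \<cdot> p n \<in> Hom M (FObj A n) X'" and i: "i n \<cdot> g \<in> Hom M Y (FObj B n)" for n
    using nA nB Compose_Hom[OF _ f(1)] Compose_Hom[OF g(1)]
    by (auto simp: nat_trans_def const_functor_def delta_def)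
  have "ho_sset_arr U (hom_diag_arr M A A ?a B B ?b) \<cdot>\<^bsub>Ho_sSet U\<^esub> ?h' = ?h \<cdot>\<^bsub>Ho_sSet U\<^esub> map_arr f g"
    unfolding map_arr_def
  proof (rule nat[OF A A' f(1) _ _ B' B g(1)])
    show "nat_trans delta M A A ?a"
      using category_delta category_axioms Af by (rule nat_trans_Ident)
    show "nat_trans (op_cat delta) M B B ?b"
      using category_op_cat[OF category_delta] category_axioms Bf by (rule nat_trans_Ident)
    show "\<forall>n. f \<cdot> p n \<cdot> ?a n = f \<cdot> p n" using Compose_Ident[OF p] by simp
    show "\<forall>n. ?b n \<cdot> (i n \<cdot> g) = i n \<cdot> g" using Ident_Compose[OF i] by simp
  qed
  moreover have "ho_sset_arr U (hom_diag_arr M A A ?a B B ?b) = Ident (Ho_sSet U) (hom_diag M A B)"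
  proof -
    \<comment> \<open>The diagonal is a simplicial set as it is the target of the arrow \<open>?h\<close>.\<close>
    have "hom_diag M A B \<in> Obj (sSet U)"
      using Ho_sSet.Hom_Obj(2)[OF h1[THEN conjunct1]] by (simp add: Ho_sSet_def)
    then show ?thesis
      using hom_diag_arr_Ident[OF Af Bf] sSet.loc_arr_Ident
      by (simp add: ho_sset_arr_def Ho_sSet_def)
  qed
  ultimately have "?h \<cdot>\<^bsub>Ho_sSet U\<^esub> map_arr f g = ?h'"
    using h2 Ho_sSet.Ident_Compose by metis
  then show ?thesis
    using Ho_sSet.iso_arrow_right_factor[OF map_arr_Hom[OF f(1) g(1)], of ?h] h1 h2 by auto
qed

definition post :: "'o \<Rightarrow> ('o, 'a, 'a sset, 'a ho_sset_arrow) fnctr" where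
  "post Z = \<lparr>FObj = (\<lambda>Y. FObj Mp (Z, Y)), FArr = (\<lambda>g. map_arr (Ident M Z) g)\<rparr>"

definition pre :: "'o \<Rightarrow> ('o, 'a, 'a sset, 'a ho_sset_arrow) fnctr" where
  "pre Z = \<lparr>FObj = (\<lambda>X. FObj Mp (X, Z)), FArr = (\<lambda>f. map_arr f (Ident M Z))\<rparr>"

lemma post_inverting:
  assumes Z: "Z \<in> Obj M" shows "inverting_functor M (Ho_sSet U) (Weq M) (post Z)"
proof
  note I = Ident_Hom[OF Z]
  have c: "map_arr (Ident M Z) (g \<cdot> f) = map_arr (Ident M Z) g \<cdot>\<^bsub>Ho_sSet U\<^esub> map_arr (Ident M Z) f"
    if "f \<in> Hom M X Y" "g \<in> Hom M Y V" for f g X Y V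
    using map_arr_Compose[OF I I that] Compose_Ident[OF I] by simp
  show "is_functor M (Ho_sSet U) (post Z)"
    using map_arr_Hom[OF I] map_arr_Ident[OF Z] Ho_sSet.Hom_Obj(1)[OF map_arr_Hom[OF I Ident_Hom]] c
    by (auto simp: is_functor_def post_def Hom_iff[of _ M])
  show "iso_arrow (Ho_sSet U) (FArr (post Z) w)" if "w \<in> Weq M" "w \<in> Arr M" for w
    using map_arr_Weq[OF I Ident_Weq[OF Z] _ that(1)] that(2) by (auto simp: post_def Hom_iff[of _ M])
qed

lemma pre_inverting:
  assumes Z: "Z \<in> Obj M" shows "inverting_functor M (op_cat (Ho_sSet U)) (Weq M) (pre Z)"
proof
  note I = Ident_Hom[OF Z]
  have c: "map_arr (g \<cdot> f) (Ident M Z) = map_arr f (Ident M Z) \<cdot>\<^bsub>Ho_sSet U\<^esub> map_arr g (Ident M Z)"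
    if "f \<in> Hom M X Y" "g \<in> Hom M Y V" for f g X Y V
    using map_arr_Compose[OF that I I] Compose_Ident[OF I] by simp
  show "is_functor M (op_cat (Ho_sSet U)) (pre Z)"
    using map_arr_Hom[OF _ I] map_arr_Ident[OF _ Z] c
      Ho_sSet.Hom_Obj(1)[OF map_arr_Hom[OF Ident_Hom I]]
    by (auto simp: is_functor_def pre_def Hom_iff[of _ M])
  show "iso_arrow (op_cat (Ho_sSet U)) (FArr (pre Z) w)" if "w \<in> Weq M" "w \<in> Arr M" for w
    using map_arr_Weq[OF _ that(1) I Ident_Weq[OF Z]] that(2) by (auto simp: pre_def Hom_iff[of _ M])
qed

lemma map_post_eq: "map_post M U Mp Z = FArr (loc_extension M (Ho_sSet U) (post Z))"
  by (simp add: map_post_def post_def map_arr_def)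

lemma map_pre_eq: "map_pre M U Mp Z = FArr (loc_extension M (op_cat (Ho_sSet U)) (pre Z))"
  by (simp add: map_pre_def pre_def map_arr_def)

lemma post_extension:
  "Z \<in> Obj M \<Longrightarrow> is_functor (Ho M) (Ho_sSet U) (loc_extension M (Ho_sSet U) (post Z))"
  unfolding Ho_def by (intro inverting_functor.is_functor_loc_extension post_inverting)

lemma pre_extension:
  "Z \<in> Obj M \<Longrightarrow> is_functor (Ho M) (op_cat (Ho_sSet U)) (loc_extension M (op_cat (Ho_sSet U)) (pre Z))"
  unfolding Ho_def by (intro inverting_functor.is_functor_loc_extension pre_inverting)

lemma map_post_Hom:
  "Z \<in> Obj M \<Longrightarrow> g \<in> Hom (Ho M) Y Y' \<Longrightarrow>
    map_post M U Mp Z g \<in> Hom (Ho_sSet U) (FObj Mp (Z, Y)) (FObj Mp (Z, Y'))"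
  using is_functorD(2)[OF post_extension, of Z g Y Y']
  by (simp add: map_post_eq loc_extension_def post_def)

lemma map_pre_Hom:
  "Z \<in> Obj M \<Longrightarrow> f \<in> Hom (Ho M) X X' \<Longrightarrow>
    map_pre M U Mp Z f \<in> Hom (Ho_sSet U) (FObj Mp (X', Z)) (FObj Mp (X, Z))"
  using is_functorD(2)[OF pre_extension, of Z f X X']
  by (simp add: map_pre_eq loc_extension_def pre_def)

lemma map_post_iso:
  "Z \<in> Obj M \<Longrightarrow> iso_arrow (Ho M) g \<Longrightarrow> iso_arrow (Ho_sSet U) (map_post M U Mp Z g)"
  unfolding map_post_eq by (intro functor_iso_arrow[OF category_Ho category_Ho_sSet post_extension])

text \<open>The interchange law is reached in two steps.  For \<open>v\<close> in \<open>M\<close>, bifunctoriality makes \<open>v\<^sub>*\<close> a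
  transformation between contravariant functors on \<open>M\<close>, which therefore is natural on \<open>Ho M\<close>.
  Read the other way round, this says that \<open>f\<^sup>*\<close>, for \<open>f\<close> in \<open>Ho M\<close>, is natural with respect to
  \<open>M\<close> in the second variable, so it too is natural with respect to \<open>Ho M\<close>.\<close>

lemma map_pre_map_post:
  assumes f: "f \<in> Hom (Ho M) X X'" and g: "g \<in> Hom (Ho M) Y Y'"
  shows "map_post M U Mp X g \<cdot>\<^bsub>Ho_sSet U\<^esub> map_pre M U Mp Y f =
    map_pre M U Mp Y' f \<cdot>\<^bsub>Ho_sSet U\<^esub> map_post M U Mp X' g"
proof -
  have X: "X \<in> Obj M" "X' \<in> Obj M"
    using Ho.Hom_Obj[OF f] by (auto simp: Ho_def)
  have pre: "nat_trans (Ho M) (op_cat (Ho_sSet U)) (loc_extension M (op_cat (Ho_sSet U)) (pre V'))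
      (loc_extension M (op_cat (Ho_sSet U)) (pre V)) (\<lambda>X. map_arr (Ident M X) v)"
    if v: "v \<in> Hom M V V'" for v V V'
  proof -
    note V = Hom_Obj[OF v]
    have "map_arr (Ident M X) v \<cdot>\<^bsub>Ho_sSet U\<^esub> map_arr u (Ident M V) =
        map_arr u (Ident M V') \<cdot>\<^bsub>Ho_sSet U\<^esub> map_arr (Ident M X') v" if u: "u \<in> Hom M X X'" for u X X'
      using map_arr_Compose[OF Ident_Hom u Ident_Hom v] map_arr_Compose[OF u Ident_Hom v Ident_Hom]
        Hom_Obj[OF u] V Ident_Compose[OF u] Ident_Compose[OF v] Compose_Ident[OF u] Compose_Ident[OF v]
      by simp
    then have "nat_trans M (op_cat (Ho_sSet U)) (pre V') (pre V) (\<lambda>X. map_arr (Ident M X) v)"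
      using map_arr_Hom[OF Ident_Hom v] by (auto simp: nat_trans_def pre_def Hom_iff[of _ M])
    then show ?thesis
      unfolding Ho_def by (intro nat_trans_loc_extension pre_inverting V)
  qed
  have "nat_trans M (Ho_sSet U) (post X') (post X) (\<lambda>Y. map_pre M U Mp Y f)"
    unfolding nat_trans_def
  proof (intro conjI ballI)
    fix V assume "V \<in> Obj M"
    then show "map_pre M U Mp V f \<in> Hom (Ho_sSet U) (FObj (post X') V) (FObj (post X) V)"
      using map_pre_Hom[OF _ f] by (simp add: post_def)
  next
    fix v assume "v \<in> Arr M"
    then have "v \<in> Hom M (Src M v) (Tgt M v)" by (simp add: Hom_iff)
    from pre[OF this] show "map_pre M U Mp (Tgt M v) f \<cdot>\<^bsub>Ho_sSet U\<^esub> FArr (post X') v =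
        FArr (post X) v \<cdot>\<^bsub>Ho_sSet U\<^esub> map_pre M U Mp (Src M v) f"
      using f by (auto simp: nat_trans_def post_def map_pre_eq Hom_iff)
  qed
  then have "nat_trans (Ho M) (Ho_sSet U) (loc_extension M (Ho_sSet U) (post X'))
      (loc_extension M (Ho_sSet U) (post X)) (\<lambda>Y. map_pre M U Mp Y f)"
    unfolding Ho_def by (intro nat_trans_loc_extension post_inverting X)
  then show ?thesis using g by (auto simp: nat_trans_def map_post_eq Hom_iff)
qed

end


section \<open>The localization theorem\<close>

theorem theorem2p1:
  fixes M :: "('o, 'a, 'm) model_cat_scheme"
    and U :: "'a set"
    and Mp :: "('o, 'a) mapping_functor"
    and L :: "('o, ('o, 'a) loc_arrow, 'o, ('o, 'a) loc_arrow) fnctr"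
    and \<eta> :: "'o \<Rightarrow> ('o, 'a) loc_arrow"
    and l :: "'o \<Rightarrow> 'o \<Rightarrow> 'a ho_sset_arrow"
  assumes "uncountable U"
    and "model_category M U"
    and "homotopy_function_complexes M U Mp"
    and "is_functor (Ho M) (Ho M) L"
    \<comment> \<open>(a)\<close>
    and "nat_trans (Ho M) (Ho M) id_functor L \<eta>"
    and "\<forall>X\<in>Obj M. FArr L (\<eta> X) = \<eta> (FObj L X)"
    and "\<forall>X\<in>Obj M. iso_arrow (Ho M) (FArr L (\<eta> X))"
    \<comment> \<open>(b)\<close>
    and "\<forall>X\<in>Obj M. \<forall>Y\<in>Obj M.
           l X Y \<in> Hom (Ho_sSet U) (FObj Mp (X, Y)) (FObj Mp (FObj L X, FObj L Y))"
    and "\<forall>X\<in>Obj M. \<forall>X'\<in>Obj M. \<forall>Y\<in>Obj M. \<forall>f\<in>Hom (Ho M) X X'.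
           l X Y \<cdot>\<^bsub>Ho_sSet U\<^esub> map_pre M U Mp Y f =
           map_pre M U Mp (FObj L Y) (FArr L f) \<cdot>\<^bsub>Ho_sSet U\<^esub> l X' Y"
    and "\<forall>X\<in>Obj M. \<forall>Y\<in>Obj M. \<forall>Y'\<in>Obj M. \<forall>g\<in>Hom (Ho M) Y Y'.
           l X Y' \<cdot>\<^bsub>Ho_sSet U\<^esub> map_post M U Mp X g =
           map_post M U Mp (FObj L X) (FArr L g) \<cdot>\<^bsub>Ho_sSet U\<^esub> l X Y"
    \<comment> \<open>(c)\<close>
    and "\<forall>X\<in>Obj M. \<forall>Y\<in>Obj M.
           map_pre M U Mp (FObj L Y) (\<eta> X) \<cdot>\<^bsub>Ho_sSet U\<^esub> l X Y = map_post M U Mp X (\<eta> Y)"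
  shows "\<forall>X\<in>Obj M. \<forall>Y\<in>Obj M.
           iso_arrow (Ho_sSet U) (map_pre M U Mp (FObj L Y) (\<eta> X)) \<and>
           map_pre M U Mp (FObj L Y) (\<eta> X) \<in>
             Hom (Ho_sSet U) (FObj Mp (FObj L X, FObj L Y)) (FObj Mp (X, FObj L Y))"
proof (intro ballI)
  interpret function_complexes M U Mp
    using assms(2,3) by (simp add: function_complexes_def function_complexes_axioms_def)
  have Obj_Ho: "Obj (Ho M) = Obj M" by (simp add: Ho_def localization_def)
  have LObj: "FObj L X \<in> Obj M" if "X \<in> Obj M" for X
    using is_functorD(1)[OF assms(4)] that by (simp add: Obj_Ho)
  have \<eta>: "\<eta> X \<in> Hom (Ho M) X (FObj L X)" if "X \<in> Obj M" for X
    using assms(5) that by (simp add: nat_trans_def id_functor_def Obj_Ho)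
  fix X Y assume X: "X \<in> Obj M" and Y: "Y \<in> Obj M"
  let ?S = "Ho_sSet U"
  note LX = LObj[OF X] and LY = LObj[OF Y]
  note LLY = LObj[OF LY]
  let ?pre = "map_pre M U Mp (FObj L Y) (\<eta> X)"
    and ?pre' = "map_pre M U Mp (FObj L (FObj L Y)) (\<eta> X)"
    and ?post = "map_post M U Mp (FObj L X) (\<eta> (FObj L Y))"
    and ?post' = "map_post M U Mp X (\<eta> (FObj L Y))"
  have iso: "iso_arrow (Ho M) (\<eta> (FObj L Y))" using assms(6,7) Y by simp
  have pre: "?pre \<in> Hom ?S (FObj Mp (FObj L X, FObj L Y)) (FObj Mp (X, FObj L Y))"
    and pre': "?pre' \<in> Hom ?S (FObj Mp (FObj L X, FObj L (FObj L Y))) (FObj Mp (X, FObj L (FObj L Y)))"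
    and post: "?post \<in> Hom ?S (FObj Mp (FObj L X, FObj L Y)) (FObj Mp (FObj L X, FObj L (FObj L Y)))"
    and post': "?post' \<in> Hom ?S (FObj Mp (X, FObj L Y)) (FObj Mp (X, FObj L (FObj L Y)))"
    using map_pre_Hom[OF _ \<eta>[OF X]] map_post_Hom[OF _ \<eta>[OF LY]] X LX LY LLY by auto
  have l: "l X (FObj L Y) \<in> Hom ?S (FObj Mp (X, FObj L Y)) (FObj Mp (FObj L X, FObj L (FObj L Y)))"
    and l': "l (FObj L X) (FObj L Y) \<in>
      Hom ?S (FObj Mp (FObj L X, FObj L Y)) (FObj Mp (FObj L (FObj L X), FObj L (FObj L Y)))"
    using assms(8) X LX LY by auto
  note k = Ho_sSet.inv_arrow[OF post map_post_iso[OF LX iso]]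
  note k' = Ho_sSet.inv_arrow[OF post' map_post_iso[OF X iso]]
  let ?k = "inv_arrow ?S ?post"
  let ?g = "?k \<cdot>\<^bsub>?S\<^esub> l X (FObj L Y)"
  have g: "?g \<in> Hom ?S (FObj Mp (X, FObj L Y)) (FObj Mp (FObj L X, FObj L Y))"
    using l k(1) by (rule Ho_sSet.Compose_Hom)
  have "l X (FObj L Y) \<cdot>\<^bsub>?S\<^esub> ?pre =
      map_pre M U Mp (FObj L (FObj L Y)) (\<eta> (FObj L X)) \<cdot>\<^bsub>?S\<^esub> l (FObj L X) (FObj L Y)"
    using assms(9) X LX LY \<eta>[OF X] assms(6) by simp
  also have "\<dots> = ?post" using assms(11) LX LY by simp
  finally have "?g \<cdot>\<^bsub>?S\<^esub> ?pre = Ident ?S (FObj Mp (FObj L X, FObj L Y))"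
    using Ho_sSet.Compose_assoc[OF pre l k(1)] k(2) by simp
  moreover have "?pre \<cdot>\<^bsub>?S\<^esub> ?g = Ident ?S (FObj Mp (X, FObj L Y))"
  proof -
    \<comment> \<open>\<open>?post'\<close> is invertible, so it suffices to prove the equation after composing with it.\<close>
    have "?post' \<cdot>\<^bsub>?S\<^esub> (?pre \<cdot>\<^bsub>?S\<^esub> ?g) = ?pre' \<cdot>\<^bsub>?S\<^esub> (?post \<cdot>\<^bsub>?S\<^esub> ?g)"
      using map_pre_map_post[OF \<eta>[OF X] \<eta>[OF LY]]
        Ho_sSet.Compose_assoc[OF g pre post'] Ho_sSet.Compose_assoc[OF g post pre'] by simp
    also have "?post \<cdot>\<^bsub>?S\<^esub> ?g = l X (FObj L Y)"
      using Ho_sSet.Compose_assoc[OF l k(1) post] k(3) Ho_sSet.Ident_Compose[OF l] by simp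
    also have "?pre' \<cdot>\<^bsub>?S\<^esub> l X (FObj L Y) = ?post'" using assms(11) X LY by simp
    finally have "inv_arrow ?S ?post' \<cdot>\<^bsub>?S\<^esub> (?post' \<cdot>\<^bsub>?S\<^esub> (?pre \<cdot>\<^bsub>?S\<^esub> ?g)) =
      inv_arrow ?S ?post' \<cdot>\<^bsub>?S\<^esub> ?post'" by simp
    then show ?thesis
      using Ho_sSet.Compose_Hom[OF g pre] Ho_sSet.Compose_assoc[OF _ post' k'(1)] k'(2)
        Ho_sSet.Ident_Compose by metis
  qed
  ultimately show "iso_arrow ?S ?pre \<and>
      ?pre \<in> Hom ?S (FObj Mp (FObj L X, FObj L Y)) (FObj Mp (X, FObj L Y))"
    using pre g Ho_sSet.inverse_arrows_iff[OF pre, of ?g] unfolding iso_arrow_def by blast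
qed

end
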